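(* Let $X$ be a Euclidean space, let $m,\ell$ be positive integers, $I:=\{1,\dots,m\}$, $J:=\{1,\dots,\ell\}$, and let $\{C_i\}_{i\in I}$ be closed subsets of $X$ with $C:=\bigcap_{i\in I}C_i\neq\varnothing$. For every $j\in J$ let $\lambda_j,\mu_j\in(0,2]$, $\widehat\beta_j:=\big(\frac{\lambda_j}{2-\lambda_j}+\frac{\mu_j}{2-\mu_j}\big)^{-1}$ (with $\widehat\beta_j:=0$ if $\lambda_j=2$ or $\mu_j=2$), $\alpha_j\in(0,1+\widehat\beta_j)$, and $s_j,t_j\in I$ with $s_j\neq t_j$, such that $\{s_j\}_{j\in J}\cup\{t_j\}_{j\in J}=I$. For $j\in J$ set $T_j:=(1-\alpha_j)\mathrm{Id}+\alpha_jP_{C_{t_j}}^{\mu_j}P_{C_{s_j}}^{\lambda_j}$, $L_j:=\operatorname{aff}(C_{s_j}\cup C_{t_j})$, and let $Z_j:=(C_{s_j}\cap C_{t_j})+(L_j-L_j)^\perp$ if $\lambda_j=\mu_j=2$ and $Z_j:=C_{s_j}\cap C_{t_j}$ otherwise. Let $w\in C$. Suppose that $\{Z_j\}_{j\in J}$ is linearly regular around $w$, that every $C_i$ ($i\in I$) is superregular at $w$, and that for every $j\in J$ the pair $\{C_{s_j},C_{t_j}\}$ is linearly regular around $w$ if $\min\{\lambda_j,\mu_j\}<2$ and affine-hull regular at $w$ otherwise. Then the cyclic algorithm defined by $(T_j)_{j\in J}$ converges $R$-linearly locally (around $w$) to a point $$\overline{x}\in\bigcap_{j\in J}Z_j\subseteq\bigcap_{j\in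 J}\operatorname{Fix}T_j.$$ Moreover, $P_{C_1}\overline{x}=\cdots=P_{C_m}\overline{x}\in C$ provided that the cyclic algorithm is connected.
   Context: A Euclidean space is a finite-dimensional real inner product space; $\mathbb{N}=\{0,1,2,\dots\}$; $\mathbb{B}(w;\rho)$ is the closed ball with center $w$ and radius $\rho$. For nonempty $S\subseteq X$: $d_S(x)=\inf_{c\in S}\|x-c\|$, and $P_Sx=\{c\in S:\|x-c\|=d_S(x)\}$ is the (set-valued) projector, identified with its element when it is a singleton (so $P_{C_1}\overline{x}=\cdots\in C$ means all these sets are the same singleton $\{p\}$ with $p\in C$). The relaxed projector is $P_S^\lambda:=(1-\lambda)\mathrm{Id}+\lambda P_S$ (set-valued). Set-valued operators are composed in the usual way: $T_jx=\{(1-\alpha_j)x+\alpha_js: s\in P_{C_{t_j}}^{\mu_j}r,\ r\in P_{C_{s_j}}^{\lambda_j}x\}$. $\operatorname{Fix}T=\{x:x\in Tx\}$; $\operatorname{aff}$ is the affine hull. A cyclic sequence generated by $(T_j)_{j\in J}$ is any sequence with $x_0\in X$ and $x_{n+1}\in T_{n+1}x_n$ for all $n\in\mathbb{N}$, where $T_{\ell n+j}:=T_j$ for $n\in\mathbb{N}$, $j\in J$. $R$-linear convergence of $(x_n)$ to $\overline{x}$ means that there are $\rho\in[0,1)$ and $\sigma\ge0$ with $\|x_n-\overline{x}\|\le\sigma\rho^n$ for all $n$. "Converges $R$-linearly locally to a point with a given property" means: there is $r>0$ such that every cyclic sequence with $x_0\in\mathbb{B}(w;r)$ converges $R$-linearly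 to some point $\overline{x}$ (depending on the sequence) with that property. The algorithm is connected if the undirected graph with vertex set $I$ and edges $\{s_j,t_j\}$, $j\in J$, is connected. A finite system $\{S_k\}_{k\in K}$ of closed sets is linearly regular around $w$ if there are $\delta,\kappa>0$ with $d_S(x)\le\kappa\max_{k\in K}d_{S_k}(x)$ for all $x\in\mathbb{B}(w;\delta)$, where $S:=\bigcap_{k\in K}S_k$. Proximal normal cone to $S$ at $x\in S$: $N^{\rm prox}_S(x)=\{\lambda(z-x): z\in X,\ x\in P_Sz,\ \lambda\ge0\}$. Limiting normal cone: $N_S(x)=\{u:\exists x_n\to x,\ u_n\to u,\ x_n\in S,\ u_n\in N_S^{\rm prox}(x_n)\}$. $S$ is superregular at $w$ if for every $\varepsilon>0$ there is $\delta>0$ such that $\langle u,x-y\rangle\ge-\varepsilon\|u\|\|x-y\|$ for all $x,y\in S\cap\mathbb{B}(w;\delta)$ and $u\in N^{\rm prox}_S(x)$. A pair $\{A,B\}$ with $w\in A\cap B$ is affine-hull regular at $w$ if $N_A(w)\cap(-N_B(w))\cap(L-w)=\{0\}$ with $L=\operatorname{aff}(A\cup B)$. *)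

theory Defs
  imports
    "HOL-Analysis.Analysis"
    "HOL-Library.Set_Algebras"
    "Graph_Theory.Digraph_Component"
begin

definition projector :: "'a::euclidean_space set \<Rightarrow> 'a \<Rightarrow> 'a set" where
  "projector S x = {c \<in> S. dist x c = infdist x S}"

definition relaxed_projector :: "real \<Rightarrow> 'a::euclidean_space set \<Rightarrow> 'a \<Rightarrow> 'a set" where
  "relaxed_projector lam S x = {(1 - lam) *\<^sub>R x + lam *\<^sub>R p | p. p \<in> projector S x}"

text \<open>The set-valued operator $(1-\alpha)\mathrm{Id} + \alpha P_B^{\mu} P_A^{\lambda}$:
  the set \<open>A\<close> (with parameter \<open>lam\<close>) is applied first.\<close>

definition relaxed_operator ::
    "real \<Rightarrow> real \<Rightarrow> 'a::euclidean_space set \<Rightarrow> real \<Rightarrow> 'a set \<Rightarrow> 'a \<Rightarrow> 'a set" where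
  "relaxed_operator \<alpha> lam A mu B x =
     {(1 - \<alpha>) *\<^sub>R x + \<alpha> *\<^sub>R q | q r. r \<in> relaxed_projector lam A x \<and> q \<in> relaxed_projector mu B r}"

definition Fix :: "('a \<Rightarrow> 'a set) \<Rightarrow> 'a set" where
  "Fix T = {x. x \<in> T x}"

definition beta_hat :: "real \<Rightarrow> real \<Rightarrow> real" where
  "beta_hat lam mu =
     (if lam = 2 \<or> mu = 2 then 0 else inverse (lam / (2 - lam) + mu / (2 - mu)))"

text \<open>The operators are indexed by \<open>{1..l}\<close>, so the periodic extension satisfies
  $T_{n+1} = T_{(n \bmod l) + 1}$.\<close>

definition cyclic_sequence :: "nat \<Rightarrow> (nat \<Rightarrow> 'a \<Rightarrow> 'a set) \<Rightarrow> (nat \<Rightarrow> 'a) \<Rightarrow> bool" where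
  "cyclic_sequence l T x \<longleftrightarrow> (\<forall>n. x (Suc n) \<in> T (n mod l + 1) (x n))"

definition R_linearly_convergent :: "(nat \<Rightarrow> 'a::real_normed_vector) \<Rightarrow> 'a \<Rightarrow> bool" where
  "R_linearly_convergent x xbar \<longleftrightarrow>
     (\<exists>\<rho> \<sigma>. 0 \<le> \<rho> \<and> \<rho> < 1 \<and> 0 \<le> \<sigma> \<and> (\<forall>n. norm (x n - xbar) \<le> \<sigma> * \<rho> ^ n))"

definition linearly_regular_around ::
    "'k set \<Rightarrow> ('k \<Rightarrow> 'a::euclidean_space set) \<Rightarrow> 'a \<Rightarrow> bool" where
  "linearly_regular_around K S w \<longleftrightarrow>
     (\<exists>\<delta>>0. \<exists>\<kappa>>0. \<forall>x\<in>cball w \<delta>.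
        infdist x (\<Inter>k\<in>K. S k) \<le> \<kappa> * Max ((\<lambda>k. infdist x (S k)) ` K))"

definition proximal_normal_cone :: "'a::euclidean_space set \<Rightarrow> 'a \<Rightarrow> 'a set" where
  "proximal_normal_cone S x = {c *\<^sub>R (z - x) | c z. 0 \<le> c \<and> x \<in> projector S z}"

definition limiting_normal_cone :: "'a::euclidean_space set \<Rightarrow> 'a \<Rightarrow> 'a set" where
  "limiting_normal_cone S x =
     {u. \<exists>y v. (\<forall>n. y n \<in> S \<and> v n \<in> proximal_normal_cone S (y n)) \<and>
               y \<longlonglongrightarrow> x \<and> v \<longlonglongrightarrow> u}"

definition superregular_at :: "'a::euclidean_space set \<Rightarrow> 'a \<Rightarrow> bool" where
  "superregular_at S w \<longleftrightarrow>
     (\<forall>\<epsilon>>0. \<exists>\<delta>>0. \<forall>x \<in> S \<inter> cball w \<delta>. \<forall>y \<in> S \<inter> cball w \<delta>.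
        \<forall>u \<in> proximal_normal_cone S x. u \<bullet> (x - y) \<ge> - \<epsilon> * norm u * norm (x - y))"

definition affine_hull_regular_at ::
    "'a::euclidean_space set \<Rightarrow> 'a set \<Rightarrow> 'a \<Rightarrow> bool" where
  "affine_hull_regular_at A B w \<longleftrightarrow>
     limiting_normal_cone A w \<inter> uminus ` limiting_normal_cone B w
       \<inter> (\<lambda>x. x - w) ` (affine hull (A \<union> B)) = {0}"

text \<open>Pointwise difference of sets (on sets, \<open>A - B\<close> denotes the set-theoretic difference).\<close>

definition minkowski_diff :: "'a::ab_group_add set \<Rightarrow> 'a set \<Rightarrow> 'a set" where
  "minkowski_diff A B = {a - b | a b. a \<in> A \<and> b \<in> B}"

text \<open>\<open>Digraph_Component.connected\<close> symmetrises the arcs, i.e. it is connectedness of the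
  underlying undirected graph, which here has vertices \<open>{1..m}\<close> and edges
  $\{s_j, t_j\}$ for \<open>j \<in> {1..l}\<close>.\<close>

definition connected_algorithm :: "nat \<Rightarrow> nat \<Rightarrow> (nat \<Rightarrow> nat) \<Rightarrow> (nat \<Rightarrow> nat) \<Rightarrow> bool" where
  "connected_algorithm m l s t \<longleftrightarrow>
     Digraph_Component.connected \<lparr>verts = {1..m}, arcs = {1..l}, tail = s, head = t\<rparr>"

end

theory Submission
  imports Defs
begin

text \<open>
  Superregularity makes each relaxed projector quasi firmly Fejer monotone near \<open>w\<close> up to a factor
  \<open>1 + \<epsilon>\<close>, and the two decrease terms of a composition combine harmonically, which is where
  \<open>beta_hat\<close> comes from. So every \<open>T j\<close> satisfies
  \<open>\<parallel>y - z\<parallel>\<^sup>2 \<le> (1 + \<epsilon>) \<parallel>x - z\<parallel>\<^sup>2 - \<beta> \<parallel>x - y\<parallel>\<^sup>2\<close> for \<open>y \<in> T j x\<close>, \<open>z \<in> Z j\<close>, with \<open>\<beta>\<close>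
  independent of \<open>\<epsilon>\<close>. Regularity of the pair makes the step coercive,
  \<open>\<nu> d(x, Z j) \<le> \<parallel>x - y\<parallel>\<close>: a short step forces both relaxed projection steps to be short if
  \<open>min (lam j) (mu j) < 2\<close>. If both parameters are \<open>2\<close>, the operator commutes with translations
  orthogonal to \<open>L j\<close>, so one may work inside \<open>L j\<close>; there affine-hull regularity bounds the angle
  between normals to the two sets, and the pair is linearly regular because alternating projections
  contract. Over one cycle the steps add up to at least a multiple of
  \<open>d = d(x, \<Inter>j. Z j)\<close> by linear regularity of the \<open>Z j\<close>, so the decrease terms beat
  the factors \<open>1 + \<epsilon>\<close> and \<open>d\<close> shrinks geometrically.
\<close>

section \<open>Relaxed projectors onto superregular sets\<close>

lemma projector_iff:
  fixes S :: "'a::euclidean_space set"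
  shows "p \<in> projector S x \<longleftrightarrow> p \<in> S \<and> (\<forall>c\<in>S. norm (x - p) \<le> norm (x - c))"
proof
  assume "p \<in> projector S x"
  then show "p \<in> S \<and> (\<forall>c\<in>S. norm (x - p) \<le> norm (x - c))"
    by (metis (mono_tags, lifting) dist_norm infdist_le mem_Collect_eq projector_def)
next
  assume p: "p \<in> S \<and> (\<forall>c\<in>S. norm (x - p) \<le> norm (x - c))"
  then have "dist x p \<le> infdist x S"
    unfolding infdist_def by (auto intro!: cINF_greatest simp: dist_norm)
  moreover have "infdist x S \<le> dist x p"
    using p by (intro infdist_le) blast
  ultimately show "p \<in> projector S x"
    unfolding projector_def using p by simp
qed

lemma projector_norm:
  "p \<in> projector S x \<Longrightarrow> norm (x - p) = infdist x S"
  unfolding projector_def dist_norm by blast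

lemma projector_nonempty:
  fixes S :: "'a::euclidean_space set"
  assumes "closed S" "S \<noteq> {}"
  obtains p where "p \<in> projector S x"
proof -
  obtain p where "p \<in> S" "infdist x S = dist x p"
    using infdist_attains_inf[OF assms] by blast
  then show ?thesis using that unfolding projector_def by simp
qed

lemma projector_self:
  fixes S :: "'a::euclidean_space set"
  assumes "x \<in> S"
  shows "projector S x = {x}"
  using assms by (force simp: projector_iff)

lemma projector_dist_le:
  fixes S :: "'a::euclidean_space set"
  assumes "p \<in> projector S x" "w \<in> S"
  shows "norm (p - w) \<le> 2 * norm (x - w)"
proof -
  have "norm (x - p) \<le> norm (x - w)"
    using assms by (auto simp: projector_iff)
  then show ?thesis
    using norm_triangle_ineq4[of "x - w" "x - p"] by simp
qed

lemma projector_proximal_normal: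
  assumes "p \<in> projector S x"
  shows "x - p \<in> proximal_normal_cone S p"
proof -
  have "x - p = 1 *\<^sub>R (x - p)" by simp
  then show ?thesis
    unfolding proximal_normal_cone_def using assms zero_le_one by blast
qed

text \<open>The displacement \<open>x - p\<close> is a proximal normal at \<open>p\<close>, so
  superregularity bounds its angle with directions from \<open>p\<close> into \<open>S\<close>, now
  for arbitrary \<open>x\<close> near \<open>w\<close>. The radius is halved because projecting at
  most doubles the distance to \<open>w\<close>.\<close>

lemma superregular_projector:
  fixes S :: "'a::euclidean_space set"
  assumes "superregular_at S w" "w \<in> S" "\<epsilon> > 0"
  shows "\<exists>\<delta>>0. \<forall>x\<in>cball w \<delta>. \<forall>z\<in>S \<inter> cball w \<delta>. \<forall>p\<in>projector S x.
       (x - p) \<bullet> (p - z) \<ge> - \<epsilon> * norm (x - p) * norm (p - z)"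
proof -
  obtain d where d: "d > 0" and *: "\<And>x y u. x \<in> S \<inter> cball w d \<Longrightarrow> y \<in> S \<inter> cball w d \<Longrightarrow>
      u \<in> proximal_normal_cone S x \<Longrightarrow> u \<bullet> (x - y) \<ge> - \<epsilon> * norm u * norm (x - y)"
    using assms(1,3) unfolding superregular_at_def by meson
  show ?thesis
  proof (intro exI[of _ "d / 2"] conjI ballI)
    show "d / 2 > 0" using d by simp
    fix x z p assume x: "x \<in> cball w (d / 2)" and z: "z \<in> S \<inter> cball w (d / 2)"
      and p: "p \<in> projector S x"
    have "p \<in> S \<inter> cball w d"
      using projector_dist_le[OF p \<open>w \<in> S\<close>] x p
      by (auto simp: projector_iff dist_norm norm_minus_commute)
    moreover have "z \<in> S \<inter> cball w d" using z d by auto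
    ultimately show "(x - p) \<bullet> (p - z) \<ge> - \<epsilon> * norm (x - p) * norm (p - z)"
      using * projector_proximal_normal[OF p] by blast
  qed
qed

lemma relaxed_projectorE:
  assumes "r \<in> relaxed_projector lam S x"
  obtains p where "p \<in> projector S x" "r = x - lam *\<^sub>R (x - p)"
proof -
  obtain p where "p \<in> projector S x" "r = (1 - lam) *\<^sub>R x + lam *\<^sub>R p"
    using assms unfolding relaxed_projector_def by blast
  moreover have "(1 - lam) *\<^sub>R x + lam *\<^sub>R p = x - lam *\<^sub>R (x - p)"
    by (simp add: algebra_simps)
  ultimately show ?thesis using that by simp
qed

lemma relaxed_projector_dist_le:
  fixes S :: "'a::euclidean_space set"
  assumes "r \<in> relaxed_projector lam S x" "w \<in> S" "0 < lam" "lam \<le> 2"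
  shows "norm (r - w) \<le> 3 * norm (x - w)"
proof -
  obtain p where p: "p \<in> projector S x" "r = x - lam *\<^sub>R (x - p)"
    using assms(1) by (rule relaxed_projectorE)
  have "lam * norm (x - p) \<le> 2 * norm (x - w)"
    using p(1) assms by (intro mult_mono) (auto simp: projector_iff)
  moreover have "norm (r - w) \<le> norm (x - w) + lam * norm (x - p)"
  proof -
    have "r - w = (x - w) - lam *\<^sub>R (x - p)" using p(2) by simp
    then have "norm (r - w) \<le> norm (x - w) + norm (lam *\<^sub>R (x - p))"
      by (metis norm_triangle_ineq4)
    then show ?thesis using assms(3) by simp
  qed
  ultimately show ?thesis by simp
qed

lemma norm_diff_scaleR_sq:
  fixes a b :: "'a::real_inner"
  shows "(norm (a - c *\<^sub>R b))\<^sup>2 = (norm a)\<^sup>2 - 2 * (c * (a \<bullet> b)) + c\<^sup>2 * (norm b)\<^sup>2"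
  using dot_norm_neg[of a "c *\<^sub>R b"] by (simp add: power_mult_distrib)

text \<open>Expand the square along the step \<open>lam *\<^sub>R (x - p)\<close>. For convex
  \<open>S\<close> the inner product of \<open>x - z\<close> and \<open>x - p\<close> is at least
  the square of \<open>norm (x - p)\<close>; superregularity gives this up to a small multiple of
  the square of \<open>norm (x - z)\<close>. For a reflection, \<open>lam = 2\<close>, the decrease
  term vanishes.\<close>

lemma relaxed_projector_fejer:
  fixes S :: "'a::euclidean_space set"
  assumes "superregular_at S w" "w \<in> S" "0 < lam" "lam \<le> 2" "\<epsilon> > 0"
  shows "\<exists>\<delta>>0. \<forall>x\<in>cball w \<delta>. \<forall>z\<in>S \<inter> cball w \<delta>. \<forall>r\<in>relaxed_projector lam S x.
       (norm (r - z))\<^sup>2 \<le> (1 + \<epsilon>) * (norm (x - z))\<^sup>2 - (2 - lam) / lam * (norm (x - r))\<^sup>2"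
proof -
  \<comment> \<open>With \<open>norm (x - p)\<close> at most \<open>norm (x - z)\<close> and
    \<open>norm (p - z)\<close> at most twice that, \<epsilon>/8 becomes an error \<epsilon>/4 in
    the inner product, which enters the square with the factor \<open>2 * lam\<close>, at most
    4.\<close>
  obtain \<delta> where d: "\<delta> > 0" and *: "\<forall>x\<in>cball w \<delta>. \<forall>z\<in>S \<inter> cball w \<delta>.
      \<forall>p\<in>projector S x. (x - p) \<bullet> (p - z) \<ge> - (\<epsilon>/8) * norm (x - p) * norm (p - z)"
    using superregular_projector[OF assms(1,2), of "\<epsilon>/8"] assms(5) by (auto simp del: mem_cball)
  show ?thesis
  proof (intro exI[of _ \<delta>] conjI ballI)
    show "\<delta> > 0" by fact
    fix x z r assume x: "x \<in> cball w \<delta>" and z: "z \<in> S \<inter> cball w \<delta>"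
      and "r \<in> relaxed_projector lam S x"
    then obtain p where p: "p \<in> projector S x" and r: "r = x - lam *\<^sub>R (x - p)"
      by (auto elim: relaxed_projectorE)
    have "norm (x - p) * norm (p - z) \<le> norm (x - z) * (2 * norm (x - z))"
      using p z projector_dist_le[OF p] by (intro mult_mono) (auto simp: projector_iff)
    then have "(\<epsilon>/8) * (norm (x - p) * norm (p - z)) \<le> (\<epsilon>/8) * (norm (x - z) * (2 * norm (x - z)))"
      using assms by (intro mult_left_mono) auto
    then have "(x - p) \<bullet> (p - z) \<ge> - (\<epsilon>/4) * (norm (x - z))\<^sup>2"
      using *[rule_format, OF x z p] by (simp add: power2_eq_square algebra_simps)
    moreover have "(x - z) \<bullet> (x - p) = (norm (x - p))\<^sup>2 + (x - p) \<bullet> (p - z)"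
    proof -
      have "x - z = (x - p) + (p - z)" by simp
      then show ?thesis by (metis inner_add_left inner_commute power2_norm_eq_inner)
    qed
    ultimately have "lam * ((norm (x - p))\<^sup>2 - (\<epsilon>/4) * (norm (x - z))\<^sup>2) \<le> lam * ((x - z) \<bullet> (x - p))"
      using assms by (intro mult_left_mono) auto
    then have "2 * lam * (norm (x - p))\<^sup>2 - 2 * (lam * ((x - z) \<bullet> (x - p))) \<le> 2 * (lam * (\<epsilon>/4) * (norm (x - z))\<^sup>2)"
      unfolding right_diff_distrib by linarith
    moreover have "(norm (r - z))\<^sup>2 = (norm (x - z))\<^sup>2 - 2 * (lam * ((x - z) \<bullet> (x - p)))
        + lam\<^sup>2 * (norm (x - p))\<^sup>2"
    proof -
      have "r - z = (x - z) - lam *\<^sub>R (x - p)" unfolding r by simp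
      then show ?thesis by (simp only: norm_diff_scaleR_sq)
    qed
    moreover have "lam * (\<epsilon>/4) * (norm (x - z))\<^sup>2 \<le> 2 * (\<epsilon>/4) * (norm (x - z))\<^sup>2"
      using assms by (intro mult_right_mono) auto
    moreover have "(2 - lam) / lam * (norm (x - r))\<^sup>2 = 2 * lam * (norm (x - p))\<^sup>2 - lam\<^sup>2 * (norm (x - p))\<^sup>2"
    proof -
      have "norm (x - r) = lam * norm (x - p)" using r assms by simp
      moreover have "(2 - lam) / lam * (lam * k)\<^sup>2 = 2 * lam * k\<^sup>2 - lam\<^sup>2 * k\<^sup>2" for k
        using assms by (simp add: field_simps power2_eq_square)
      ultimately show ?thesis by simp
    qed
    moreover have "(1 + \<epsilon>) * (norm (x - z))\<^sup>2 = (norm (x - z))\<^sup>2 + 2 * (2 * (\<epsilon>/4) * (norm (x - z))\<^sup>2)"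
      by (simp add: distrib_right)
    ultimately show "(norm (r - z))\<^sup>2 \<le> (1 + \<epsilon>) * (norm (x - z))\<^sup>2 - (2 - lam) / lam * (norm (x - r))\<^sup>2"
      by linarith
  qed
qed

lemma two_relaxed_projectors_fejer:
  fixes A B :: "'a::euclidean_space set"
  assumes "superregular_at A w" "superregular_at B w" "w \<in> A" "w \<in> B"
    "0 < lam" "lam \<le> 2" "0 < mu" "mu \<le> 2" "\<epsilon> > 0"
  shows "\<exists>\<delta>>0. \<forall>x\<in>cball w \<delta>. \<forall>z\<in>A \<inter> B \<inter> cball w \<delta>.
       \<forall>r\<in>relaxed_projector lam A x. \<forall>q\<in>relaxed_projector mu B r.
       (norm (q - z))\<^sup>2 \<le> (1 + \<epsilon>) * (norm (x - z))\<^sup>2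
          - (2 - lam) / lam * (norm (x - r))\<^sup>2 - (2 - mu) / mu * (norm (r - q))\<^sup>2"
proof -
  \<comment> \<open>Chosen so that the square of \<open>1 + e\<close>, which is at most
    \<open>1 + 3 * e\<close>, stays below \<open>1 + \<epsilon>\<close>.\<close>
  define e where "e = min 1 (\<epsilon> / 3)"
  have e: "0 < e" "e \<le> 1" "3 * e \<le> \<epsilon>" using assms by (auto simp: e_def)
  obtain d1 where d1: "d1 > 0" and A: "\<forall>x\<in>cball w d1. \<forall>z\<in>A \<inter> cball w d1.
      \<forall>r\<in>relaxed_projector lam A x.
      (norm (r - z))\<^sup>2 \<le> (1 + e) * (norm (x - z))\<^sup>2 - (2 - lam) / lam * (norm (x - r))\<^sup>2"
    using relaxed_projector_fejer[OF assms(1,3,5,6) e(1)] by blast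
  obtain d2 where d2: "d2 > 0" and B: "\<forall>x\<in>cball w d2. \<forall>z\<in>B \<inter> cball w d2.
      \<forall>r\<in>relaxed_projector mu B x.
      (norm (r - z))\<^sup>2 \<le> (1 + e) * (norm (x - z))\<^sup>2 - (2 - mu) / mu * (norm (x - r))\<^sup>2"
    using relaxed_projector_fejer[OF assms(2,4,7,8) e(1)] by blast
  \<comment> \<open>A relaxed projection at most triples the distance to \<open>w\<close>, and the
    inequality for \<open>B\<close> is applied at the intermediate point \<open>r\<close>.\<close>
  define d where "d = min d1 (d2 / 3)"
  show ?thesis
  proof (intro exI[of _ d] conjI ballI)
    show "d > 0" using d1 d2 by (simp add: d_def)
    fix x z r q assume x: "x \<in> cball w d" and z: "z \<in> A \<inter> B \<inter> cball w d"
      and r: "r \<in> relaxed_projector lam A x" and q: "q \<in> relaxed_projector mu B r"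
    have "r \<in> cball w d2"
      using relaxed_projector_dist_le[OF r \<open>w \<in> A\<close>] assms x
      by (auto simp: dist_norm norm_minus_commute d_def)
    moreover have "z \<in> B \<inter> cball w d2" using z d2 by (auto simp: d_def)
    ultimately have 1: "(norm (q - z))\<^sup>2 \<le> (1 + e) * (norm (r - z))\<^sup>2 - (2 - mu) / mu * (norm (r - q))\<^sup>2"
      using B q by blast
    have 2: "(norm (r - z))\<^sup>2 \<le> (1 + e) * (norm (x - z))\<^sup>2 - (2 - lam) / lam * (norm (x - r))\<^sup>2"
      using A x z r by (auto simp: d_def)
    have "(1 + e) * (norm (r - z))\<^sup>2 \<le>
        (1 + e) * ((1 + e) * (norm (x - z))\<^sup>2 - (2 - lam) / lam * (norm (x - r))\<^sup>2)"
      using 2 e by (intro mult_left_mono) auto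
    also have "\<dots> = (1 + e)\<^sup>2 * (norm (x - z))\<^sup>2 - (1 + e) * ((2 - lam) / lam * (norm (x - r))\<^sup>2)"
      by (simp only: right_diff_distrib power2_eq_square mult.assoc)
    also have "\<dots> \<le> (1 + \<epsilon>) * (norm (x - z))\<^sup>2 - 1 * ((2 - lam) / lam * (norm (x - r))\<^sup>2)"
    proof (intro diff_mono mult_right_mono)
      have "e * e \<le> e" using mult_left_mono[OF e(2), of e] e by simp
      moreover have "(1 + e)\<^sup>2 = 1 + 2 * e + e * e" by (simp add: power2_eq_square algebra_simps)
      ultimately show "(1 + e)\<^sup>2 \<le> 1 + \<epsilon>" using e by linarith
    qed (use assms e in auto)
    finally show "(norm (q - z))\<^sup>2 \<le> (1 + \<epsilon>) * (norm (x - z))\<^sup>2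
          - (2 - lam) / lam * (norm (x - r))\<^sup>2 - (2 - mu) / mu * (norm (r - q))\<^sup>2"
      using 1 by linarith
  qed
qed

section \<open>Averaged compositions of two relaxed projectors\<close>

text \<open>\<open>beta_hat\<close> is the minimum of the right-hand side over \<open>a + b = 1\<close>.\<close>

lemma beta_hat_le:
  assumes "0 < lam" "lam \<le> 2" "0 < mu" "mu \<le> 2" "0 \<le> c" "0 \<le> a" "0 \<le> b" "c \<le> a + b"
  shows "beta_hat lam mu * c\<^sup>2 \<le> (2 - lam) / lam * a\<^sup>2 + (2 - mu) / mu * b\<^sup>2"
proof (cases "lam = 2 \<or> mu = 2")
  case True
  then show ?thesis using assms by (auto simp: beta_hat_def)
next
  case False
  define f g where "f = (2 - lam) / lam" and "g = (2 - mu) / mu"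
  have pos: "f > 0" "g > 0" using False assms by (auto simp: f_def g_def)
  have "beta_hat lam mu = inverse (1 / f + 1 / g)"
    using False by (simp add: beta_hat_def f_def g_def)
  also have "\<dots> = f * g / (f + g)" using pos by (simp add: field_simps)
  finally have bh: "beta_hat lam mu = f * g / (f + g)" .
  have "c\<^sup>2 \<le> (a + b)\<^sup>2" using assms by (intro power_mono) auto
  then have "f * g * c\<^sup>2 \<le> f * g * (a + b)\<^sup>2"
    using pos by (intro mult_left_mono) auto
  \<comment> \<open>Cauchy-Schwarz with its defect made explicit: equality holds when
    \<open>f * a = g * b\<close>.\<close>
  also have "\<dots> = (f + g) * (f * a\<^sup>2 + g * b\<^sup>2) - (f * a - g * b)\<^sup>2"
    by (simp add: power2_eq_square algebra_simps)
  also have "\<dots> \<le> (f + g) * (f * a\<^sup>2 + g * b\<^sup>2)" by simp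
  finally have "f * g * c\<^sup>2 / (f + g) \<le> f * a\<^sup>2 + g * b\<^sup>2"
    using pos by (simp add: pos_divide_le_eq mult.commute)
  then show ?thesis unfolding bh f_def[symmetric] g_def[symmetric] by simp
qed

lemma relaxed_operatorE:
  assumes "y \<in> relaxed_operator \<alpha> lam A mu B x"
  obtains r q where "r \<in> relaxed_projector lam A x" "q \<in> relaxed_projector mu B r"
    "y = x - \<alpha> *\<^sub>R (x - q)"
proof -
  obtain r q where "r \<in> relaxed_projector lam A x" "q \<in> relaxed_projector mu B r"
    "y = (1 - \<alpha>) *\<^sub>R x + \<alpha> *\<^sub>R q"
    using assms unfolding relaxed_operator_def by blast
  moreover have "(1 - \<alpha>) *\<^sub>R x + \<alpha> *\<^sub>R q = x - \<alpha> *\<^sub>R (x - q)"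
    by (simp add: algebra_simps)
  ultimately show ?thesis using that by simp
qed

text \<open>Writing \<open>y\<close> as the affine combination of \<open>x\<close> and
  \<open>q\<close> with weight \<alpha> expresses the distance to \<open>z\<close> through those of
  \<open>x\<close> and \<open>q\<close>, with the correction
  \<open>- \<alpha> * (1 - \<alpha>) * Q\<close>; this identity holds also for \<alpha> above 1. The
  decrease of the composition contributes a further \<open>- \<alpha> * beta_hat lam mu * Q\<close>.
  As \<open>norm (x - y)\<close> is \<alpha> times \<open>norm (x - q)\<close>, the two combine to
  the stated witness, positive by the bound on \<alpha>. It is fixed before \<epsilon>.\<close>

lemma relaxed_operator_fejer:
  fixes A B :: "'a::euclidean_space set"
  assumes "superregular_at A w" "superregular_at B w" "w \<in> A" "w \<in> B"
    "0 < lam" "lam \<le> 2" "0 < mu" "mu \<le> 2" "0 < \<alpha>" "\<alpha> < 1 + beta_hat lam mu"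
  shows "\<exists>\<beta>>0. \<forall>\<epsilon>>0. \<exists>\<delta>>0. \<forall>x\<in>cball w \<delta>. \<forall>z\<in>A \<inter> B \<inter> cball w \<delta>.
     \<forall>y\<in>relaxed_operator \<alpha> lam A mu B x.
       (norm (y - z))\<^sup>2 \<le> (1 + \<epsilon>) * (norm (x - z))\<^sup>2 - \<beta> * (norm (x - y))\<^sup>2"
proof (rule exI[of _ "(1 - \<alpha> + beta_hat lam mu) / \<alpha>"], intro conjI allI impI)
  let ?b = "beta_hat lam mu"
  show "(1 - \<alpha> + ?b) / \<alpha> > 0" using assms by simp
  fix \<epsilon> :: real assume "\<epsilon> > 0"
  \<comment> \<open>The error of the composition is weighted by \<alpha> in the affine combination,
    so \<epsilon>/\<alpha> yields \<epsilon>.\<close>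
  then have "\<epsilon> / \<alpha> > 0" using assms by simp
  from two_relaxed_projectors_fejer[OF assms(1-8) this]
  obtain \<delta> where d: "\<delta> > 0" and *: "\<forall>x\<in>cball w \<delta>. \<forall>z\<in>A \<inter> B \<inter> cball w \<delta>.
       \<forall>r\<in>relaxed_projector lam A x. \<forall>q\<in>relaxed_projector mu B r.
       (norm (q - z))\<^sup>2 \<le> (1 + \<epsilon> / \<alpha>) * (norm (x - z))\<^sup>2
          - (2 - lam) / lam * (norm (x - r))\<^sup>2 - (2 - mu) / mu * (norm (r - q))\<^sup>2"
    by blast
  show "\<exists>\<delta>>0. \<forall>x\<in>cball w \<delta>. \<forall>z\<in>A \<inter> B \<inter> cball w \<delta>. \<forall>y\<in>relaxed_operator \<alpha> lam A mu B x.
       (norm (y - z))\<^sup>2 \<le> (1 + \<epsilon>) * (norm (x - z))\<^sup>2 - (1 - \<alpha> + ?b) / \<alpha> * (norm (x - y))\<^sup>2"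
  proof (intro exI[of _ \<delta>] conjI ballI)
    show "\<delta> > 0" by fact
    fix x z y assume x: "x \<in> cball w \<delta>" and z: "z \<in> A \<inter> B \<inter> cball w \<delta>"
      and "y \<in> relaxed_operator \<alpha> lam A mu B x"
    then obtain r q where r: "r \<in> relaxed_projector lam A x" and q: "q \<in> relaxed_projector mu B r"
      and y: "y = x - \<alpha> *\<^sub>R (x - q)"
      by (auto elim: relaxed_operatorE)
    define N Q I where "N = (norm (x - z))\<^sup>2" and "Q = (norm (x - q))\<^sup>2"
      and "I = (x - z) \<bullet> (x - q)"
    have "norm (x - q) \<le> norm (x - r) + norm (r - q)"
      using norm_triangle_ineq[of "x - r" "r - q"] by simp
    then have "?b * Q \<le> (2 - lam) / lam * (norm (x - r))\<^sup>2 + (2 - mu) / mu * (norm (r - q))\<^sup>2"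
      unfolding Q_def using assms by (intro beta_hat_le) auto
    moreover have "(norm (q - z))\<^sup>2 \<le> (1 + \<epsilon> / \<alpha>) * N
          - (2 - lam) / lam * (norm (x - r))\<^sup>2 - (2 - mu) / mu * (norm (r - q))\<^sup>2"
      using *[rule_format, OF x z r q] by (simp add: N_def)
    moreover have "(norm (q - z))\<^sup>2 = N - 2 * I + Q"
    proof -
      have "q - z = (x - z) - 1 *\<^sub>R (x - q)" by simp
      then show ?thesis unfolding N_def Q_def I_def by (simp only: norm_diff_scaleR_sq) simp
    qed
    ultimately have "N - 2 * I + Q \<le> (1 + \<epsilon> / \<alpha>) * N - ?b * Q" by linarith
    then have "\<alpha> * (N - 2 * I + Q) \<le> \<alpha> * ((1 + \<epsilon> / \<alpha>) * N - ?b * Q)"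
      using assms by (intro mult_left_mono) auto
    moreover have "\<alpha> * ((1 + \<epsilon> / \<alpha>) * N - ?b * Q) = \<alpha> * N + \<epsilon> * N - \<alpha> * ?b * Q"
      using assms by (simp add: field_simps)
    moreover have "(1 - \<alpha> + ?b) / \<alpha> * (\<alpha>\<^sup>2 * Q) = (1 - \<alpha> + ?b) * (\<alpha> * Q)"
      using assms by (simp add: power2_eq_square)
    ultimately have "N - 2 * (\<alpha> * I) + \<alpha>\<^sup>2 * Q \<le> (1 + \<epsilon>) * N - (1 - \<alpha> + ?b) / \<alpha> * (\<alpha>\<^sup>2 * Q)"
      by (simp add: algebra_simps power2_eq_square)
    moreover have "(norm (y - z))\<^sup>2 = N - 2 * (\<alpha> * I) + \<alpha>\<^sup>2 * Q"
    proof -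
      have "y - z = (x - z) - \<alpha> *\<^sub>R (x - q)" using y by simp
      then show ?thesis unfolding N_def Q_def I_def by (simp only: norm_diff_scaleR_sq)
    qed
    moreover have "(norm (x - y))\<^sup>2 = \<alpha>\<^sup>2 * Q"
      using y by (simp add: Q_def power_mult_distrib)
    ultimately show "(norm (y - z))\<^sup>2 \<le> (1 + \<epsilon>) * (norm (x - z))\<^sup>2 - (1 - \<alpha> + ?b) / \<alpha> * (norm (x - y))\<^sup>2"
      by (simp add: N_def)
  qed
qed

section \<open>Coercivity when one of the two parameters is below 2\<close>

text \<open>\<open>X\<close>, \<open>Y\<close> and \<open>Q\<close> stand for the two relaxed
  projection steps and the total displacement. The larger weight controls its own step by
  \<open>k\<close>; the triangle inequality with \<open>Q\<close> at most \<open>k\<close> transfers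
  the bound to the other step, whose weight may be zero.\<close>

lemma steps_le_of_sq:
  fixes a b X Y Q k :: real
  assumes "0 \<le> a" "0 \<le> b" "0 < max a b" "a * X\<^sup>2 + b * Y\<^sup>2 \<le> max a b * k\<^sup>2"
    "0 \<le> k" "X \<le> Y + Q" "Y \<le> X + Q" "0 \<le> Q" "Q \<le> k"
  shows "X \<le> 2 * k \<and> Y \<le> 2 * k"
proof -
  have nn: "0 \<le> a * X\<^sup>2" "0 \<le> b * Y\<^sup>2" using assms by simp_all
  have "X \<le> k \<or> Y \<le> k"
  proof (cases "b \<le> a")
    case True
    then have m: "max a b = a" by simp
    then have "a * X\<^sup>2 \<le> a * k\<^sup>2" using assms(4)[unfolded m] nn by linarith
    then have "X\<^sup>2 \<le> k\<^sup>2" using m assms(3) by (metis mult_le_cancel_left_pos)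
    then show ?thesis using \<open>0 \<le> k\<close> power2_le_imp_le by blast
  next
    case False
    then have m: "max a b = b" by simp
    then have "b * Y\<^sup>2 \<le> b * k\<^sup>2" using assms(4)[unfolded m] nn by linarith
    then have "Y\<^sup>2 \<le> k\<^sup>2" using m assms(3) by (metis mult_le_cancel_left_pos)
    then show ?thesis using \<open>0 \<le> k\<close> power2_le_imp_le by blast
  qed
  then show ?thesis using assms by linarith
qed

text \<open>Suppose the displacement is below \<open>e * D\<close>, with \<open>D\<close> the
  distance to the intersection. The Fejer inequality at the nearest common point then leaves no room
  for long partial steps, so both are small multiples of \<open>D\<close>. Hence \<open>x\<close> is
  very close to \<open>A\<close> and to \<open>B\<close>, and regularity gives that \<open>D\<close>
  is at most \<open>D / 2\<close>.\<close>

lemma relaxed_operator_coercive: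
  fixes A B :: "'a::euclidean_space set"
  assumes "superregular_at A w" "superregular_at B w" "w \<in> A" "w \<in> B"
    "0 < lam" "lam \<le> 2" "0 < mu" "mu \<le> 2" "0 < \<alpha>"
    and "closed A" "closed B" "min lam mu < 2"
    and reg: "d0 > 0" "\<kappa> > 0"
      "\<forall>x\<in>cball w d0. infdist x (A \<inter> B) \<le> \<kappa> * max (infdist x A) (infdist x B)"
  shows "\<exists>\<nu>>0. \<exists>\<delta>>0. \<forall>x\<in>cball w \<delta>. \<forall>y\<in>relaxed_operator \<alpha> lam A mu B x.
       \<nu> * infdist x (A \<inter> B) \<le> norm (x - y)"
proof -
  define a b where "a = (2 - lam) / lam" and "b = (2 - mu) / mu"
  have ab: "0 \<le> a" "0 \<le> b" using assms by (auto simp: a_def b_def)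
  have g: "0 < max a b"
  proof -
    have "lam < 2 \<or> mu < 2" using \<open>min lam mu < 2\<close> by auto
    then have "0 < a \<or> 0 < b" using \<open>0 < lam\<close> \<open>0 < mu\<close> by (auto simp: a_def b_def)
    then show ?thesis by auto
  qed
  \<comment> \<open>A relaxed step is \<open>lam\<close> (or \<open>mu\<close>) times the distance
    to its set. The distance to \<open>B\<close> is measured from \<open>r\<close>, so
    \<open>norm (x - r)\<close> is added, which is the summand 1.\<close>
  define M where "M = 1 + 1 / lam + 1 / mu"
  have M: "M > 0" "1 / lam \<le> M" "1 + 1 / mu \<le> M" using assms by (auto simp: M_def add_pos_pos)
  \<comment> \<open>Makes the final regularity estimate of \<open>D\<close> equal to
    \<open>D / 2\<close>.\<close>
  define \<tau> where "\<tau> = 1 / (4 * \<kappa> * M)"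
  have tau: "\<tau> > 0" "\<kappa> * (M * (2 * \<tau>)) = 1 / 2" using M reg by (auto simp: \<tau>_def)
  \<comment> \<open>The factor 3 counts one \<open>e\<close> from the Fejer factor
    \<open>1 + e\<close> and two from the cross term of \<open>norm (q - z)\<close>.\<close>
  define e where "e = min \<tau> (max a b * \<tau>\<^sup>2 / 3)"
  have e: "e > 0" "e \<le> \<tau>" "3 * e \<le> max a b * \<tau>\<^sup>2" using tau g by (auto simp: e_def)
  obtain d1 where d1: "d1 > 0" and *: "\<forall>x\<in>cball w d1. \<forall>z\<in>A \<inter> B \<inter> cball w d1.
       \<forall>r\<in>relaxed_projector lam A x. \<forall>q\<in>relaxed_projector mu B r.
       (norm (q - z))\<^sup>2 \<le> (1 + e) * (norm (x - z))\<^sup>2 - a * (norm (x - r))\<^sup>2 - b * (norm (r - q))\<^sup>2"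
    using two_relaxed_projectors_fejer[OF assms(1-8) e(1)] unfolding a_def b_def by blast
  have "\<alpha> * e > 0" "min d0 (d1 / 2) > 0" using assms(9) e reg d1 by auto
  moreover have "\<forall>x\<in>cball w (min d0 (d1 / 2)). \<forall>y\<in>relaxed_operator \<alpha> lam A mu B x.
       \<alpha> * e * infdist x (A \<inter> B) \<le> norm (x - y)"
  proof (intro ballI)
    fix x y assume x: "x \<in> cball w (min d0 (d1 / 2))" and "y \<in> relaxed_operator \<alpha> lam A mu B x"
    then obtain r q where r: "r \<in> relaxed_projector lam A x" and q: "q \<in> relaxed_projector mu B r"
      and y: "y = x - \<alpha> *\<^sub>R (x - q)"
      by (auto elim: relaxed_operatorE)
    obtain z where z: "z \<in> projector (A \<inter> B) x"
      using projector_nonempty[of "A \<inter> B" x] assms by auto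
    define D where "D = infdist x (A \<inter> B)"
    have zD: "norm (x - z) = D" using projector_norm[OF z] by (simp add: D_def)
    have D0: "D \<ge> 0" by (simp add: D_def infdist_nonneg)
    have "e * D \<le> norm (x - q)"
    proof (rule ccontr)
      assume "\<not> e * D \<le> norm (x - q)"
      then have Q: "norm (x - q) \<le> e * D" and "D \<noteq> 0" by auto
      then have D: "D > 0" using D0 by simp
      have "z \<in> A \<inter> B \<inter> cball w d1"
        using projector_dist_le[OF z, of w] assms x z
        by (auto simp: projector_iff dist_norm norm_minus_commute)
      then have "(norm (q - z))\<^sup>2 \<le> (1 + e) * D\<^sup>2 - a * (norm (x - r))\<^sup>2 - b * (norm (r - q))\<^sup>2"
        using * x r q d1 zD by auto
      \<comment> \<open>A point close to \<open>x\<close> cannot be much nearer to \<open>z\<close>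
        than \<open>x\<close> is, so the decrease terms must be small.\<close>
      moreover have "(norm (q - z))\<^sup>2 \<ge> D\<^sup>2 - 2 * (D * norm (x - q))"
      proof -
        have "q - z = (x - z) - 1 *\<^sub>R (x - q)" by simp
        then have "(norm (q - z))\<^sup>2 = D\<^sup>2 - 2 * ((x - z) \<bullet> (x - q)) + (norm (x - q))\<^sup>2"
          unfolding zD[symmetric] by (simp only: norm_diff_scaleR_sq) simp
        then show ?thesis using norm_cauchy_schwarz[of "x - z" "x - q", unfolded zD]
          zero_le_power2[of "norm (x - q)"] by linarith
      qed
      moreover have "D * norm (x - q) \<le> D * (e * D)" using Q D by (intro mult_left_mono) auto
      moreover have "(1 + e) * D\<^sup>2 = D\<^sup>2 + D * (e * D)" "3 * (D * (e * D)) = 3 * e * D\<^sup>2"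
        by (simp_all add: power2_eq_square algebra_simps)
      moreover have "3 * e * D\<^sup>2 \<le> max a b * \<tau>\<^sup>2 * D\<^sup>2" using e by (intro mult_right_mono) auto
      ultimately have "a * (norm (x - r))\<^sup>2 + b * (norm (r - q))\<^sup>2 \<le> max a b * \<tau>\<^sup>2 * D\<^sup>2"
        by linarith
      moreover have "norm (x - q) \<le> \<tau> * D"
        using Q mult_right_mono[OF e(2) D0] by linarith
      moreover have "norm (x - r) \<le> norm (r - q) + norm (x - q)"
        using norm_triangle_ineq4[of "x - q" "r - q"] by simp
      moreover have "norm (r - q) \<le> norm (x - r) + norm (x - q)"
        using norm_triangle_ineq4[of "x - q" "x - r"] by simp
      ultimately have XY: "norm (x - r) \<le> 2 * (\<tau> * D) \<and> norm (r - q) \<le> 2 * (\<tau> * D)"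
        using ab g tau D by (intro steps_le_of_sq[of a b _ _ _ "norm (x - q)"])
          (auto simp: power_mult_distrib mult.assoc)
      obtain p where p: "p \<in> projector A x" "r = x - lam *\<^sub>R (x - p)"
        using r by (rule relaxed_projectorE)
      have "infdist x A = norm (x - r) / lam"
        using p projector_norm[OF p(1)] assms by simp
      also have "\<dots> \<le> 1 / lam * (2 * (\<tau> * D))"
        using XY assms by (simp add: divide_right_mono)
      also have "\<dots> \<le> M * (2 * (\<tau> * D))"
        using M tau D by (intro mult_right_mono) auto
      finally have 1: "infdist x A \<le> M * (2 * (\<tau> * D))" .
      obtain p' where p': "p' \<in> projector B r" "q = r - mu *\<^sub>R (r - p')"
        using q by (rule relaxed_projectorE)
      have "infdist x B \<le> infdist r B + norm (x - r)"
        using infdist_triangle[of x B r] by (simp add: dist_norm)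
      also have "infdist r B = norm (r - q) / mu"
        using p' projector_norm[OF p'(1)] assms by simp
      also have "norm (r - q) / mu + norm (x - r) \<le> 1 / mu * (2 * (\<tau> * D)) + 2 * (\<tau> * D)"
        using XY assms by (intro add_mono) (auto simp: divide_right_mono)
      also have "\<dots> = (1 + 1 / mu) * (2 * (\<tau> * D))" by (simp add: distrib_right)
      also have "\<dots> \<le> M * (2 * (\<tau> * D))"
        using M tau D by (intro mult_right_mono) auto
      finally have "max (infdist x A) (infdist x B) \<le> M * (2 * (\<tau> * D))" using 1 by simp
      then have "\<kappa> * max (infdist x A) (infdist x B) \<le> \<kappa> * (M * (2 * (\<tau> * D)))"
        using reg by (intro mult_left_mono) auto
      moreover have "\<kappa> * (M * (2 * (\<tau> * D))) = D / 2"
        using arg_cong[OF tau(2), of "\<lambda>t. t * D"] by (simp add: mult.assoc)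
      moreover have "D \<le> \<kappa> * max (infdist x A) (infdist x B)"
        using reg(3) x unfolding D_def by auto
      ultimately show False using D by linarith
    qed
    then have "\<alpha> * (e * D) \<le> \<alpha> * norm (x - q)" using assms by (intro mult_left_mono) auto
    then show "\<alpha> * e * infdist x (A \<inter> B) \<le> norm (x - y)"
      using y assms by (simp add: D_def mult.assoc)
  qed
  ultimately show ?thesis by blast
qed

section \<open>Compositions of two reflections\<close>

text \<open>Matches the direction space used in \<open>Z j\<close> with the translate by
  \<open>w\<close> used in affine-hull regularity.\<close>

lemma minkowski_diff_affine_hull:
  fixes S :: "'a::real_vector set"
  assumes "w \<in> affine hull S"
  shows "minkowski_diff (affine hull S) (affine hull S) = (\<lambda>x. x - w) ` (affine hull S)"
proof -
  let ?V = "(\<lambda>x. x - w) ` (affine hull S)"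
  have V: "subspace ?V"
    using affine_diffs_subspace_subtract[OF affine_affine_hull assms] .
  have "a - b \<in> ?V" if "a \<in> affine hull S" "b \<in> affine hull S" for a b
    using subspace_diff[OF V, of "a - w" "b - w"] that by auto
  then show ?thesis
    using assms unfolding minkowski_diff_def by auto
qed

lemma orthogonal_comp_inner:
  "v \<in> orthogonal_comp V \<Longrightarrow> u \<in> V \<Longrightarrow> v \<bullet> u = 0"
  by (auto simp: orthogonal_comp_def orthogonal_def inner_commute)

lemma orthogonal_comp_uminus:
  "v \<in> orthogonal_comp V \<Longrightarrow> - v \<in> orthogonal_comp V"
  by (auto simp: orthogonal_comp_def orthogonal_def)

text \<open>\<open>v\<close> has the same inner product with every point of \<open>S\<close>, so
  replacing \<open>x\<close> by \<open>x + v\<close> changes all squared distances to points of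
  \<open>S\<close> by the same constant and keeps the minimizers.\<close>

lemma projector_translate:
  fixes S L :: "'a::euclidean_space set"
  assumes "S \<subseteq> L" "v \<in> orthogonal_comp (minkowski_diff L L)"
  shows "projector S (x + v) = projector S x"
proof -
  have "norm (x + v - p) \<le> norm (x + v - c) \<longleftrightarrow> norm (x - p) \<le> norm (x - c)"
    if "p \<in> S" "c \<in> S" for p c
  proof -
    have "c - p \<in> minkowski_diff L L" using that assms(1) by (auto simp: minkowski_diff_def)
    from orthogonal_comp_inner[OF assms(2) this] have eq: "v \<bullet> c = v \<bullet> p"
      by (simp add: inner_diff_right)
    have sq: "(norm (x + v - y))\<^sup>2 = (norm (x - y))\<^sup>2 + 2 * (v \<bullet> x - v \<bullet> y) + (norm v)\<^sup>2" for y
    proof -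
      have "x + v - y = (x - y) - (-1) *\<^sub>R v" by simp
      then show ?thesis by (simp only: norm_diff_scaleR_sq) (simp add: inner_diff_right inner_commute[of _ v])
    qed
    show ?thesis
      using sq[of p] sq[of c] eq abs_le_square_iff[of "norm (x + v - p)" "norm (x + v - c)"]
        abs_le_square_iff[of "norm (x - p)" "norm (x - c)"] by auto
  qed
  then show ?thesis unfolding projector_iff by (auto simp: projector_iff)
qed

text \<open>A reflection keeps the projection and so sends the offset \<open>v\<close> to
  \<open>- v\<close>; the second reflection restores the sign. Averaging then takes place between
  two points with the same offset \<open>v\<close>.\<close>

lemma relaxed_operator_reflections_translate:
  fixes A B :: "'a::euclidean_space set"
  assumes "A \<subseteq> L" "B \<subseteq> L" "v \<in> orthogonal_comp (minkowski_diff L L)"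
    and "y \<in> relaxed_operator \<alpha> 2 A 2 B x"
  shows "y + v \<in> relaxed_operator \<alpha> 2 A 2 B (x + v)"
proof -
  obtain r q where r: "r \<in> relaxed_projector 2 A x" and q: "q \<in> relaxed_projector 2 B r"
      and y: "y = (1 - \<alpha>) *\<^sub>R x + \<alpha> *\<^sub>R q"
    using assms(4) unfolding relaxed_operator_def by blast
  obtain p where p: "p \<in> projector A x" "r = (1 - 2) *\<^sub>R x + 2 *\<^sub>R p"
    using r unfolding relaxed_projector_def by blast
  obtain p' where p': "p' \<in> projector B r" "q = (1 - 2) *\<^sub>R r + 2 *\<^sub>R p'"
    using q unfolding relaxed_projector_def by blast
  have mv: "- v \<in> orthogonal_comp (minkowski_diff L L)"
    using assms(3) by (rule orthogonal_comp_uminus)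
  have "p \<in> projector A (x + v)"
    using p(1) projector_translate[OF assms(1,3)] by simp
  moreover have "r - v = (1 - 2) *\<^sub>R (x + v) + 2 *\<^sub>R p" using p by simp
  ultimately have 1: "r - v \<in> relaxed_projector 2 A (x + v)"
    unfolding relaxed_projector_def by blast
  have "p' \<in> projector B (r - v)"
    using p'(1) projector_translate[OF assms(2) mv, of r] by simp
  moreover have "q + v = (1 - 2) *\<^sub>R (r - v) + 2 *\<^sub>R p'" using p' by simp
  ultimately have 2: "q + v \<in> relaxed_projector 2 B (r - v)"
    unfolding relaxed_projector_def by blast
  have "y + v = (1 - \<alpha>) *\<^sub>R (x + v) + \<alpha> *\<^sub>R (q + v)"
    using y by (simp add: algebra_simps)
  then show ?thesis using 1 2 unfolding relaxed_operator_def by blast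
qed

lemma relaxed_operator_common_point:
  fixes A B :: "'a::euclidean_space set"
  assumes "c \<in> A" "c \<in> B"
  shows "c \<in> relaxed_operator \<alpha> lam A mu B c"
proof -
  have eq: "c = (1 - k) *\<^sub>R c + k *\<^sub>R c" for k :: real by (simp add: algebra_simps)
  have "c \<in> relaxed_projector lam A c" "c \<in> relaxed_projector mu B c"
    unfolding relaxed_projector_def projector_self[OF assms(1)] projector_self[OF assms(2)]
    using eq by blast+
  then show ?thesis unfolding relaxed_operator_def using eq by blast
qed

lemma norm_add_orthogonal:
  fixes u v :: "'a::real_inner"
  assumes "v \<bullet> u = 0"
  shows "norm u \<le> norm (u + v)" "norm v \<le> norm (u + v)"
proof -
  have "(norm (u + v))\<^sup>2 = (norm u)\<^sup>2 + (norm v)\<^sup>2"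
    using norm_add_Pythagorean[of u v] assms by (simp add: orthogonal_def inner_commute)
  then have "(norm u)\<^sup>2 \<le> (norm (u + v))\<^sup>2" "(norm v)\<^sup>2 \<le> (norm (u + v))\<^sup>2" by simp_all
  then show "norm u \<le> norm (u + v)" "norm v \<le> norm (u + v)"
    by (simp_all only: power2_le_imp_le[OF _ norm_ge_zero])
qed

text \<open>For \<open>z = c + v\<close> subtract \<open>v\<close> from \<open>x\<close>,
  \<open>y\<close> and \<open>z\<close>: this preserves the operator and all differences, and
  reduces the claim to the common point \<open>c\<close>.\<close>

lemma reflections_fejer:
  fixes A B :: "'a::euclidean_space set"
  assumes "superregular_at A w" "superregular_at B w" "w \<in> A" "w \<in> B" "0 < \<alpha>" "\<alpha> < 1"
    and L: "L = affine hull (A \<union> B)"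
  shows "\<exists>\<beta>>0. \<forall>\<epsilon>>0. \<exists>\<delta>>0. \<forall>x\<in>cball w \<delta>.
     \<forall>z\<in>((A \<inter> B) + orthogonal_comp (minkowski_diff L L)) \<inter> cball w \<delta>.
     \<forall>y\<in>relaxed_operator \<alpha> 2 A 2 B x.
       (norm (y - z))\<^sup>2 \<le> (1 + \<epsilon>) * (norm (x - z))\<^sup>2 - \<beta> * (norm (x - y))\<^sup>2"
proof -
  have sub: "A \<subseteq> L" "B \<subseteq> L" unfolding L using hull_subset[of "A \<union> B" affine] by auto
  \<comment> \<open>\<open>beta_hat\<close> is 0 by convention when a parameter is 2.\<close>
  have "\<alpha> < 1 + beta_hat 2 2" using assms by (simp add: beta_hat_def)
  from relaxed_operator_fejer[OF assms(1-4) _ _ _ _ assms(5) this]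
  obtain \<beta> where b: "\<beta> > 0" and *: "\<forall>\<epsilon>>0. \<exists>\<delta>>0. \<forall>x\<in>cball w \<delta>. \<forall>z\<in>A \<inter> B \<inter> cball w \<delta>.
     \<forall>y\<in>relaxed_operator \<alpha> 2 A 2 B x.
       (norm (y - z))\<^sup>2 \<le> (1 + \<epsilon>) * (norm (x - z))\<^sup>2 - \<beta> * (norm (x - y))\<^sup>2"
    by auto
  show ?thesis
  proof (rule exI[of _ \<beta>], intro conjI allI impI)
    show "\<beta> > 0" by fact
    fix \<epsilon> :: real assume "\<epsilon> > 0"
    then obtain d where d: "d > 0" and F: "\<forall>x\<in>cball w d. \<forall>z\<in>A \<inter> B \<inter> cball w d.
     \<forall>y\<in>relaxed_operator \<alpha> 2 A 2 B x.
       (norm (y - z))\<^sup>2 \<le> (1 + \<epsilon>) * (norm (x - z))\<^sup>2 - \<beta> * (norm (x - y))\<^sup>2"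
      using * by blast
    show "\<exists>\<delta>>0. \<forall>x\<in>cball w \<delta>.
     \<forall>z\<in>((A \<inter> B) + orthogonal_comp (minkowski_diff L L)) \<inter> cball w \<delta>.
     \<forall>y\<in>relaxed_operator \<alpha> 2 A 2 B x.
       (norm (y - z))\<^sup>2 \<le> (1 + \<epsilon>) * (norm (x - z))\<^sup>2 - \<beta> * (norm (x - y))\<^sup>2"
    proof (rule exI[of _ "d / 2"], intro conjI ballI)
      show "d / 2 > 0" using d by simp
      fix x z y assume x: "x \<in> cball w (d / 2)"
        and z: "z \<in> ((A \<inter> B) + orthogonal_comp (minkowski_diff L L)) \<inter> cball w (d / 2)"
        and y: "y \<in> relaxed_operator \<alpha> 2 A 2 B x"
      obtain c v where c: "c \<in> A \<inter> B" and v: "v \<in> orthogonal_comp (minkowski_diff L L)"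
        and zz: "z = c + v"
        using z by (auto elim: set_plus_elim)
      have "c - w \<in> minkowski_diff L L"
        using c sub \<open>w \<in> A\<close> by (auto simp: minkowski_diff_def)
      then have "v \<bullet> (c - w) = 0" using orthogonal_comp_inner[OF v] by blast
      \<comment> \<open>Orthogonality keeps both components of \<open>z - w\<close> small:
        \<open>c\<close> stays near \<open>w\<close>, and \<open>x - v\<close> leaves the ball of
        radius \<open>d / 2\<close> around \<open>w\<close> by at most another
        \<open>d / 2\<close>.\<close>
      then have "norm (c - w) \<le> norm (z - w)" "norm v \<le> norm (z - w)"
        using norm_add_orthogonal[of v "c - w"] unfolding zz by (auto simp: algebra_simps)
      moreover have "norm (z - w) \<le> d / 2" "norm (x - w) \<le> d / 2"
        using x z by (auto simp: dist_norm norm_minus_commute)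
      moreover have "norm (x - v - w) \<le> norm (x - w) + norm v"
        using norm_triangle_ineq4[of "x - w" v] by (simp add: algebra_simps)
      ultimately have "norm (c - w) \<le> d" "norm (x - v - w) \<le> d" using d by linarith+
      then have "c \<in> A \<inter> B \<inter> cball w d" "x - v \<in> cball w d"
        using c by (auto simp: dist_norm norm_minus_commute)
      moreover have "y - v \<in> relaxed_operator \<alpha> 2 A 2 B (x - v)"
        using relaxed_operator_reflections_translate[OF sub orthogonal_comp_uminus[OF v] y] by simp
      ultimately have "(norm ((y - v) - c))\<^sup>2 \<le>
          (1 + \<epsilon>) * (norm ((x - v) - c))\<^sup>2 - \<beta> * (norm ((x - v) - (y - v)))\<^sup>2"
        using F by blast
      moreover have "(y - v) - c = y - z" "(x - v) - c = x - z" "(x - v) - (y - v) = x - y"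
        unfolding zz by simp_all
      ultimately show "(norm (y - z))\<^sup>2 \<le> (1 + \<epsilon>) * (norm (x - z))\<^sup>2 - \<beta> * (norm (x - y))\<^sup>2"
        by simp
    qed
  qed
qed

section \<open>Normal cones and the angle between the two sets\<close>

lemma proximal_normal_cone_scale:
  assumes "u \<in> proximal_normal_cone S x" "0 \<le> c"
  shows "c *\<^sub>R u \<in> proximal_normal_cone S x"
proof -
  obtain d z where "u = d *\<^sub>R (z - x)" "0 \<le> d" "x \<in> projector S z"
    using assms(1) unfolding proximal_normal_cone_def by blast
  moreover from this have "c *\<^sub>R u = (c * d) *\<^sub>R (z - x)" "0 \<le> c * d" using assms(2) by simp_all
  ultimately show ?thesis unfolding proximal_normal_cone_def by blast
qed

lemma limiting_normal_coneI:
  assumes "\<And>n. y n \<in> S" "\<And>n. v n \<in> proximal_normal_cone S (y n)"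
    "y \<longlonglongrightarrow> x" "v \<longlonglongrightarrow> u"
  shows "u \<in> limiting_normal_cone S x"
  using assms unfolding limiting_normal_cone_def by blast

text \<open>Compactness argument. Otherwise there are nearly opposite normals in \<open>V\<close> at
  points tending to \<open>w\<close>; normalized so that their norms add up to 1, they converge
  along a subsequence to \<open>l\<close> and \<open>- l\<close>. These are limiting normals at
  \<open>w\<close>, so regularity forces \<open>l = 0\<close>, against the normalization.\<close>

lemma affine_hull_regular_angle:
  fixes A B :: "'a::euclidean_space set"
  assumes "affine_hull_regular_at A B w" "w \<in> A"
    and V: "V = (\<lambda>x. x - w) ` (affine hull (A \<union> B))"
  shows "\<exists>\<theta>>0. \<exists>\<delta>>0. \<forall>a\<in>A \<inter> cball w \<delta>. \<forall>b\<in>B \<inter> cball w \<delta>.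
     \<forall>u\<in>proximal_normal_cone A a \<inter> V. \<forall>v\<in>proximal_normal_cone B b \<inter> V.
       \<theta> * (norm u + norm v) \<le> norm (u + v)"
proof (rule ccontr)
  assume neg: "\<not> ?thesis"
  \<comment> \<open>One number serves both as the radius and as the angle constant, so a single null
    sequence suffices.\<close>
  have "\<exists>a b u v. a \<in> A \<inter> cball w \<delta> \<and> b \<in> B \<inter> cball w \<delta> \<and> u \<in> proximal_normal_cone A a \<inter> V \<and>
      v \<in> proximal_normal_cone B b \<inter> V \<and> norm (u + v) < \<delta> * (norm u + norm v)" if "\<delta> > 0" for \<delta>
  proof (rule ccontr)
    assume "\<not> ?thesis"
    then have "\<forall>a\<in>A \<inter> cball w \<delta>. \<forall>b\<in>B \<inter> cball w \<delta>.
        \<forall>u\<in>proximal_normal_cone A a \<inter> V. \<forall>v\<in>proximal_normal_cone B b \<inter> V.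
        \<delta> * (norm u + norm v) \<le> norm (u + v)"
      by (meson not_le)
    then show False using neg that by blast
  qed
  then have "\<exists>a b u v. a \<in> A \<inter> cball w (inverse (Suc n)) \<and> b \<in> B \<inter> cball w (inverse (Suc n)) \<and>
      u \<in> proximal_normal_cone A a \<inter> V \<and> v \<in> proximal_normal_cone B b \<inter> V \<and>
      norm (u + v) < inverse (Suc n) * (norm u + norm v)" for n :: nat
    by (metis inverse_positive_iff_positive of_nat_0_less_iff zero_less_Suc)
  then obtain a b u v where *: "\<And>n. a n \<in> A \<inter> cball w (inverse (Suc n))"
      "\<And>n. b n \<in> B \<inter> cball w (inverse (Suc n))"
      "\<And>n. u n \<in> proximal_normal_cone A (a n) \<inter> V" "\<And>n. v n \<in> proximal_normal_cone B (b n) \<inter> V"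
      "\<And>n. norm (u n + v n) < inverse (Suc n) * (norm (u n) + norm (v n))"
    by metis
  define k where "k n = inverse (norm (u n) + norm (v n))" for n
  \<comment> \<open>The strict inequality excludes that both normals vanish, so normalizing is
    possible.\<close>
  have pos: "norm (u n) + norm (v n) > 0" for n
  proof -
    have "0 < inverse (real (Suc n)) * (norm (u n) + norm (v n))"
      using *(5)[of n] norm_ge_zero[of "u n + v n"] by linarith
    then show ?thesis by (simp add: zero_less_mult_iff)
  qed
  define U W where "U n = k n *\<^sub>R u n" and "W n = k n *\<^sub>R v n" for n
  have V_sub: "subspace V"
    unfolding V using assms(2) by (intro affine_diffs_subspace_subtract affine_affine_hull hull_inc) auto
  have k: "k n > 0" for n using pos by (simp add: k_def)
  have UN: "U n \<in> proximal_normal_cone A (a n)" "U n \<in> V" for n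
    using *(3)[of n] k[of n] V_sub by (auto simp: U_def intro: proximal_normal_cone_scale subspace_scale)
  have WN: "W n \<in> proximal_normal_cone B (b n)" "W n \<in> V" for n
    using *(4)[of n] k[of n] V_sub by (auto simp: W_def intro: proximal_normal_cone_scale subspace_scale)
  have sum1: "norm (U n) + norm (W n) = 1" for n
  proof -
    have "norm (U n) + norm (W n) = k n * (norm (u n) + norm (v n))"
      using k[of n] by (simp add: U_def W_def distrib_left)
    then show ?thesis using pos[of n] by (simp add: k_def)
  qed
  have small: "norm (U n + W n) \<le> inverse (Suc n)" for n
  proof -
    have "norm (U n + W n) = k n * norm (u n + v n)"
      using k[of n] by (simp add: U_def W_def flip: scaleR_add_right)
    also have "\<dots> \<le> k n * (inverse (Suc n) * (norm (u n) + norm (v n)))"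
      using *(5)[of n] k[of n] by (intro mult_left_mono) auto
    also have "\<dots> = inverse (Suc n)" using pos[of n] by (simp add: k_def)
    finally show ?thesis .
  qed
  have "U n \<in> cball 0 1" for n using sum1[of n] norm_ge_zero[of "W n"] by (simp del: norm_ge_zero)
  then obtain l f where f: "strict_mono f" and lim: "(U \<circ> f) \<longlonglongrightarrow> l"
    using compact_cball[of "0::'a" 1] unfolding compact_def by meson
  have inv: "(\<lambda>n. inverse (real (Suc (f n)))) \<longlonglongrightarrow> 0"
    using LIMSEQ_subseq_LIMSEQ[OF LIMSEQ_inverse_real_of_nat f] by (simp add: o_def)
  have "(\<lambda>n. U (f n) + W (f n)) \<longlonglongrightarrow> 0"
    by (rule tendsto_norm_zero_cancel, rule tendsto_sandwich[OF _ _ tendsto_const inv])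
      (use small in auto)
  then have "(\<lambda>n. (U (f n) + W (f n)) - U (f n)) \<longlonglongrightarrow> 0 - l"
    using lim by (intro tendsto_diff) (auto simp: o_def)
  then have limW: "(\<lambda>n. W (f n)) \<longlonglongrightarrow> - l" by simp
  have lim_w: "(\<lambda>n. g (f n)) \<longlonglongrightarrow> w" if "\<And>n. g n \<in> cball w (inverse (Suc n))" for g
  proof -
    have "dist (g n) w \<le> inverse (Suc n)" for n using that[of n] by (simp add: dist_commute)
    then have "(\<lambda>n. dist (g (f n)) w) \<longlonglongrightarrow> 0"
      by (intro tendsto_sandwich[OF _ _ tendsto_const inv]) auto
    then show ?thesis by (rule tendsto_dist_iff[THEN iffD2])
  qed
  have lima: "(\<lambda>n. a (f n)) \<longlonglongrightarrow> w" and limb: "(\<lambda>n. b (f n)) \<longlonglongrightarrow> w"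
    using *(1,2) by (blast intro: lim_w)+
  have limU: "(\<lambda>n. U (f n)) \<longlonglongrightarrow> l" using lim by (simp add: o_def)
  have mem: "a (f n) \<in> A" "b (f n) \<in> B" for n
    using *(1,2)[of "f n"] by blast+
  have "l \<in> limiting_normal_cone A w"
    by (rule limiting_normal_coneI[OF mem(1) UN(1) lima limU])
  moreover have "- l \<in> limiting_normal_cone B w"
    by (rule limiting_normal_coneI[OF mem(2) WN(1) limb limW])
  moreover have "l \<in> V"
    using Lim_in_closed_set[OF closed_subspace[OF V_sub] _ _ limU] UN(2) by simp
  ultimately have "l \<in> limiting_normal_cone A w \<inter> uminus ` limiting_normal_cone B w \<inter> V"
    by (auto intro!: image_eqI[of l uminus "- l"])
  then have "l = 0"
    using assms(1) unfolding affine_hull_regular_at_def V by blast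
  moreover have "(\<lambda>n. norm (U (f n)) + norm (W (f n))) \<longlonglongrightarrow> norm l + norm (- l)"
    by (intro tendsto_intros limU limW)
  ultimately show False
    unfolding sum1 using LIMSEQ_unique[OF tendsto_const] by fastforce
qed

text \<open>Applied to consecutive steps \<open>v = a - b\<close> and \<open>u = b - a'\<close> of alternating projections, so that
  \<open>- u - v = a' - a\<close>.\<close>

lemma alternating_projection_contraction:
  fixes u v :: "'a::real_inner"
  assumes sup: "u \<bullet> (- u - v) \<ge> - (\<theta>\<^sup>2 / 4) * norm u * norm (u + v)"
    and angle: "\<theta> * (norm u + norm v) \<le> norm (u + v)"
    and "0 < \<theta>" "\<theta> \<le> 1"
  shows "norm u \<le> (1 - \<theta>\<^sup>2 / 4) * norm v"
proof -
  define U W where "U = norm u" and "W = norm v"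
  have nn: "0 \<le> U" "0 \<le> W" by (auto simp: U_def W_def)
  have "(\<theta>\<^sup>2 / 4) * (U * norm (u + v)) \<le> (\<theta>\<^sup>2 / 4) * ((U + W) * (U + W))"
    using nn norm_triangle_ineq[of u v] by (intro mult_left_mono mult_mono) (auto simp: U_def W_def)
  moreover have "u \<bullet> (- u - v) = - U\<^sup>2 - u \<bullet> v"
    by (simp add: U_def inner_diff_right power2_norm_eq_inner)
  ultimately have 1: "U\<^sup>2 + u \<bullet> v \<le> (\<theta>\<^sup>2 / 4) * (U + W)\<^sup>2"
    using sup by (simp add: U_def[symmetric] power2_eq_square mult.assoc)
  have "(\<theta> * (U + W))\<^sup>2 \<le> (norm (u + v))\<^sup>2"
    using angle nn \<open>0 < \<theta>\<close> by (intro power_mono) (auto simp: U_def W_def)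
  also have "(norm (u + v))\<^sup>2 = U\<^sup>2 + 2 * (u \<bullet> v) + W\<^sup>2"
    by (simp add: U_def W_def power2_norm_eq_inner inner_add_left inner_add_right inner_commute)
  finally have "\<theta>\<^sup>2 * (U + W)\<^sup>2 \<le> U\<^sup>2 + 2 * (u \<bullet> v) + W\<^sup>2" by (simp add: power_mult_distrib)
  \<comment> \<open>Eliminates the inner product: the superregularity error enters twice, as half of
    \<theta> squared, and the angle bound outweighs it by another half.\<close>
  with 1 have "U\<^sup>2 \<le> W\<^sup>2 - \<theta>\<^sup>2 / 2 * (U + W)\<^sup>2" by simp
  also have "\<dots> \<le> W\<^sup>2 - \<theta>\<^sup>2 / 2 * W\<^sup>2"
    using nn by (intro diff_left_mono mult_left_mono power_mono) auto
  also have "\<dots> \<le> ((1 - \<theta>\<^sup>2 / 4) * W)\<^sup>2"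
  proof -
    have "((1 - \<theta>\<^sup>2 / 4) * W)\<^sup>2 = W\<^sup>2 - \<theta>\<^sup>2 / 2 * W\<^sup>2 + (\<theta>\<^sup>2 / 4 * W)\<^sup>2"
      by (simp add: power2_eq_square algebra_simps)
    then show ?thesis by simp
  qed
  finally have "U\<^sup>2 \<le> ((1 - \<theta>\<^sup>2 / 4) * W)\<^sup>2" .
  moreover have "0 \<le> (1 - \<theta>\<^sup>2 / 4) * W"
    using nn assms(3,4) power_le_one[of \<theta> 2] by (intro mult_nonneg_nonneg) auto
  ultimately show ?thesis unfolding U_def W_def by (rule power2_le_imp_le)
qed

section \<open>Local linear regularity from alternating projections\<close>

text \<open>One round moves the point by at most twice the gap \<open>infdist a B\<close> and
  shrinks the gap by the factor \<open>c\<close>. A common point therefore lies within a fixed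
  multiple of the initial gap, as a geometric series of the movements suggests.\<close>

lemma descent_imp_error_bound:
  fixes A B :: "'a::euclidean_space set"
  assumes "closed A" "closed B" "w \<in> A \<inter> B" "0 \<le> c" "c < 1" "\<delta> > 0"
    and descent: "\<And>a b a'. \<lbrakk>a \<in> A \<inter> cball w \<delta>; b \<in> projector B a; a' \<in> projector A b\<rbrakk>
      \<Longrightarrow> norm (b - a') \<le> c * norm (a - b)"
  shows "\<exists>\<delta>'>0. \<exists>K>0. \<forall>a\<in>A \<inter> cball w \<delta>'. infdist a (A \<inter> B) \<le> K * infdist a B"
proof -
  \<comment> \<open>A round turns the gap term \<open>K\<close> into at most \<open>K * c\<close>
    and adds at most \<open>1 + c\<close>, hence at most 2, to the distance term, all in units of
    the gap. With \<open>K * c + 3 = K\<close> one unit of strict decrease remains.\<close>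
  define K where "K = 3 / (1 - c)"
  have K: "K > 0" "K * c + 3 = K" using assms by (auto simp: K_def field_simps)
  \<comment> \<open>The minimizer lies within \<open>(K + 1) * \<delta>'\<close> of
    \<open>w\<close>, and two projections enlarge this distance at most fourfold, so the improved
    point is still admissible.\<close>
  define \<delta>' where "\<delta>' = \<delta> / (4 * (K + 1))"
  have d': "\<delta>' > 0" "(4 * (K + 1)) * \<delta>' = \<delta>" using assms K by (auto simp: \<delta>'_def)
  have "infdist a0 (A \<inter> B) \<le> K * infdist a0 B" if a0: "a0 \<in> A \<inter> cball w \<delta>'" for a0
  proof -
    \<comment> \<open>Caristi-type argument: a minimizer of \<open>\<phi>\<close> outside \<open>B\<close> would be improved by one round of
      alternating projections. This replaces the limit of the alternating projection sequence.\<close>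
    define \<phi> where "\<phi> a = K * infdist a B + norm (a - a0)" for a
    have "compact (A \<inter> cball w \<delta>)"
      using assms by (simp add: closed_Int_compact)
    moreover have "A \<inter> cball w \<delta> \<noteq> {}" using assms by auto
    moreover have "continuous_on (A \<inter> cball w \<delta>) \<phi>"
      unfolding \<phi>_def by (intro continuous_intros)
    ultimately obtain a where a: "a \<in> A \<inter> cball w \<delta>" and
      min: "\<And>y. y \<in> A \<inter> cball w \<delta> \<Longrightarrow> \<phi> a \<le> \<phi> y"
      using continuous_attains_inf[of "A \<inter> cball w \<delta>" \<phi>] by blast
    have "1 * \<delta>' \<le> (4 * (K + 1)) * \<delta>'" using K d' by (intro mult_right_mono) auto
    then have "\<delta>' \<le> \<delta>" unfolding d'(2) by simp
    then have "a0 \<in> A \<inter> cball w \<delta>" using a0 by auto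
    then have le: "\<phi> a \<le> K * infdist a0 B" using min[of a0] by (simp add: \<phi>_def)
    have a0w: "norm (a0 - w) \<le> \<delta>'" using a0 by (simp add: dist_norm norm_minus_commute)
    have "infdist a0 B \<le> \<delta>'"
      using infdist_le[of w B a0] assms a0w by (simp add: dist_norm)
    then have "K * infdist a0 B \<le> K * \<delta>'" using K by (intro mult_left_mono) auto
    moreover have "norm (a - a0) \<le> \<phi> a"
      using K infdist_nonneg[of a B] by (simp add: \<phi>_def)
    ultimately have "norm (a - a0) \<le> K * \<delta>'" using le by linarith
    then have aw: "norm (a - w) \<le> (K + 1) * \<delta>'"
      using norm_triangle_ineq[of "a - a0" "a0 - w"] a0w by (simp add: distrib_right)
    have "infdist a B = 0"
    proof (rule ccontr)
      assume "infdist a B \<noteq> 0"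
      then have pos: "infdist a B > 0" using infdist_nonneg[of a B] by simp
      obtain b where b: "b \<in> projector B a" using projector_nonempty[of B a] assms by auto
      obtain a' where a': "a' \<in> projector A b" using projector_nonempty[of A b] assms by auto
      have ab: "norm (a - b) = infdist a B" using projector_norm[OF b] .
      have "norm (a' - w) \<le> 4 * norm (a - w)"
        using projector_dist_le[OF a', of w] projector_dist_le[OF b, of w] assms by auto
      then have "norm (a' - w) \<le> \<delta>" using aw d' by linarith
      then have "a' \<in> A \<inter> cball w \<delta>"
        using a' by (simp add: projector_iff dist_norm norm_minus_commute)
      then have "\<phi> a \<le> \<phi> a'" by (rule min)
      moreover have ba: "norm (b - a') \<le> c * infdist a B"
        using descent[OF a b a'] ab by simp
      moreover have "infdist a' B \<le> norm (b - a')"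
        using infdist_le[of b B a'] b by (simp add: projector_iff dist_norm norm_minus_commute)
      moreover have "norm (a' - a0) \<le> norm (a - a0) + norm (a - b) + norm (b - a')"
      proof -
        have eq: "(a - a0) - (a - b) - (b - a') = a' - a0" by simp
        show ?thesis
          using norm_triangle_ineq4[of "(a - a0) - (a - b)" "b - a'", unfolded eq]
            norm_triangle_ineq4[of "a - a0" "a - b"] by linarith
      qed
      ultimately have "K * infdist a B \<le> K * infdist a' B + infdist a B + c * infdist a B"
        using ab by (simp add: \<phi>_def)
      also have "\<dots> \<le> K * (c * infdist a B) + infdist a B + 1 * infdist a B"
        using ba \<open>infdist a' B \<le> norm (b - a')\<close> K assms pos
        by (intro add_mono mult_left_mono mult_right_mono) auto
      also have "\<dots> = (K * c + 2) * infdist a B" by (simp add: algebra_simps)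
      also have "K * c + 2 = K - 1" using K by simp
      finally show False using pos by (simp add: left_diff_distrib)
    qed
    then have "a \<in> A \<inter> B"
      using a assms in_closed_iff_infdist_zero[of B a] by auto
    then have "infdist a0 (A \<inter> B) \<le> norm (a - a0)"
      using infdist_le[of a "A \<inter> B" a0] by (simp add: dist_norm norm_minus_commute)
    also have "\<dots> \<le> K * infdist a0 B" using \<open>norm (a - a0) \<le> \<phi> a\<close> le by simp
    finally show ?thesis .
  qed
  then show ?thesis using d'(1) K(1) by blast
qed

text \<open>Consecutive displacements of alternating projections are proximal normals to
  \<open>B\<close> and \<open>A\<close>, and they lie in \<open>V\<close> because both sets lie in
  \<open>w + V\<close>. The angle bound and superregularity of \<open>A\<close> make the gap
  contract, which gives the error bound on \<open>A\<close>.\<close>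

lemma angle_imp_local_regularity:
  fixes A B :: "'a::euclidean_space set"
  assumes "closed A" "closed B" "w \<in> A" "w \<in> B" "superregular_at A w" "0 < \<theta>" "0 < \<delta>"
    and V: "subspace V" "\<And>x. x \<in> A \<union> B \<Longrightarrow> x - w \<in> V"
    and angle: "\<forall>a\<in>A \<inter> cball w \<delta>. \<forall>b\<in>B \<inter> cball w \<delta>.
     \<forall>u\<in>proximal_normal_cone A a \<inter> V. \<forall>v\<in>proximal_normal_cone B b \<inter> V.
       \<theta> * (norm u + norm v) \<le> norm (u + v)"
  shows "\<exists>\<delta>'>0. \<exists>\<kappa>>0. \<forall>x\<in>cball w \<delta>'. infdist x (A \<inter> B) \<le> \<kappa> * (infdist x A + infdist x B)"
proof -
  define t where "t = min \<theta> 1"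
  have t: "0 < t" "t \<le> 1" "t \<le> \<theta>" using assms by (auto simp: t_def)
  have V_diff: "x - y \<in> V" if "x \<in> A \<union> B" "y \<in> A \<union> B" for x y
    using subspace_diff[OF V(1) V(2)[OF that(1)] V(2)[OF that(2)]] by simp
  have "t\<^sup>2 / 4 > 0" using t by simp
  from superregular_projector[OF assms(5,3) this]
  obtain d1 where d1: "d1 > 0" and sup: "\<forall>x\<in>cball w d1. \<forall>z\<in>A \<inter> cball w d1. \<forall>p\<in>projector A x.
       (x - p) \<bullet> (p - z) \<ge> - (t\<^sup>2 / 4) * norm (x - p) * norm (p - z)"
    by blast
  \<comment> \<open>Starting within \<eta> of \<open>w\<close>, the first projection stays within
    \<open>2 * \<eta>\<close> and the second within \<open>4 * \<eta>\<close>.\<close>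
  define \<eta> where "\<eta> = min \<delta> d1 / 4"
  have eta: "0 < \<eta>" "4 * \<eta> \<le> \<delta>" "4 * \<eta> \<le> d1" using assms d1 by (auto simp: \<eta>_def)
  have "norm (b - a') \<le> (1 - t\<^sup>2 / 4) * norm (a - b)"
    if a: "a \<in> A \<inter> cball w \<eta>" and b: "b \<in> projector B a" and a': "a' \<in> projector A b" for a b a'
  proof -
    have aw: "norm (a - w) \<le> \<eta>" using a by (simp add: dist_norm norm_minus_commute)
    have bw: "norm (b - w) \<le> 2 * \<eta>" using projector_dist_le[OF b \<open>w \<in> B\<close>] aw by simp
    have a'w: "norm (a' - w) \<le> 4 * \<eta>" using projector_dist_le[OF a' \<open>w \<in> A\<close>] bw by simp
    have mem: "a' \<in> A" "b \<in> B" "a \<in> A" using a a' b by (auto simp: projector_iff)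
    have "b \<in> cball w d1" "a \<in> A \<inter> cball w d1"
      using aw bw eta mem by (auto simp: dist_norm norm_minus_commute)
    then have le: "(b - a') \<bullet> (a' - a) \<ge> - (t\<^sup>2 / 4) * norm (b - a') * norm (a' - a)"
      using sup a' by blast
    have e1: "(b - a') \<bullet> (a' - a) = (b - a') \<bullet> (- (b - a') - (a - b))"
      and e2: "norm (a' - a) = norm ((b - a') + (a - b))"
      by (simp_all add: norm_minus_commute)
    have 1: "(b - a') \<bullet> (- (b - a') - (a - b)) \<ge>
        - (t\<^sup>2 / 4) * norm (b - a') * norm ((b - a') + (a - b))"
      using le by (simp only: e1[symmetric] e2[symmetric])
    have "b - a' \<in> proximal_normal_cone A a' \<inter> V" "a - b \<in> proximal_normal_cone B b \<inter> V"
      using projector_proximal_normal[OF a'] projector_proximal_normal[OF b] V_diff mem by auto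
    moreover have "a' \<in> A \<inter> cball w \<delta>" "b \<in> B \<inter> cball w \<delta>"
      using a'w bw eta mem by (auto simp: dist_norm norm_minus_commute)
    ultimately have "\<theta> * (norm (b - a') + norm (a - b)) \<le> norm ((b - a') + (a - b))"
      using angle by blast
    moreover have "t * (norm (b - a') + norm (a - b)) \<le> \<theta> * (norm (b - a') + norm (a - b))"
      using t by (intro mult_right_mono) auto
    ultimately show ?thesis
      using alternating_projection_contraction[OF 1 _ t(1,2)] by linarith
  qed
  moreover have "0 \<le> 1 - t\<^sup>2 / 4" "1 - t\<^sup>2 / 4 < 1"
    using t power_le_one[of t 2] by auto
  ultimately obtain d2 K where d2: "d2 > 0" and K: "K > 0" and
    bd: "\<forall>a\<in>A \<inter> cball w d2. infdist a (A \<inter> B) \<le> K * infdist a B"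
    using descent_imp_error_bound[of A B w "1 - t\<^sup>2 / 4" \<eta>] assms(1-4) eta(1) by blast
  \<comment> \<open>A general point is first projected onto \<open>A\<close>, at the cost of
    \<open>infdist x A\<close> in the estimates for both \<open>B\<close> and the
    intersection.\<close>
  have "infdist x (A \<inter> B) \<le> (K + 1) * (infdist x A + infdist x B)" if x: "x \<in> cball w (d2 / 2)" for x
  proof -
    obtain a where a: "a \<in> projector A x" using projector_nonempty[of A x] assms by auto
    have "norm (a - w) \<le> d2"
      using projector_dist_le[OF a \<open>w \<in> A\<close>] x by (simp add: dist_norm norm_minus_commute)
    then have "a \<in> A \<inter> cball w d2"
      using a by (simp add: projector_iff dist_norm norm_minus_commute)
    then have "infdist a (A \<inter> B) \<le> K * infdist a B" using bd by blast
    moreover have "infdist a B \<le> infdist x B + infdist x A"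
      using infdist_triangle[of a B x] projector_norm[OF a] by (simp add: dist_norm norm_minus_commute)
    then have "K * infdist a B \<le> K * (infdist x B + infdist x A)"
      using K by (intro mult_left_mono) auto
    moreover have "infdist x (A \<inter> B) \<le> infdist a (A \<inter> B) + infdist x A"
      using infdist_triangle[of x "A \<inter> B" a] projector_norm[OF a] by (simp add: dist_norm)
    ultimately show ?thesis using infdist_nonneg[of x B] by (simp add: algebra_simps)
  qed
  moreover have "d2 / 2 > 0" "K + 1 > 0" using d2 K by auto
  ultimately show ?thesis by blast
qed

lemma affine_orthogonal_decomposition:
  fixes L :: "'a::euclidean_space set"
  assumes "affine L" "w \<in> L"
  obtains y v where "x = y + v" "y \<in> L" "v \<in> orthogonal_comp ((\<lambda>x. x - w) ` L)"
    "norm (y - w) \<le> norm (x - w)"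
proof -
  let ?V = "(\<lambda>x. x - w) ` L"
  have V: "subspace ?V" using affine_diffs_subspace_subtract[OF assms] .
  obtain u v where u: "u \<in> span ?V" and orth: "\<And>k. k \<in> span ?V \<Longrightarrow> orthogonal v k"
    and eq: "x - w = u + v"
    using orthogonal_subspace_decomp_exists[of ?V "x - w"] by blast
  have uV: "u \<in> ?V" using u V by (simp add: span_eq_iff[THEN iffD2])
  show thesis
  proof
    show "x = (u + w) + v" using eq by (simp add: algebra_simps)
    show "u + w \<in> L" using uV by auto
    show "v \<in> orthogonal_comp ?V"
      unfolding orthogonal_comp_def using orth span_base orthogonal_commute by blast
    have "v \<bullet> u = 0" using orth[OF u] by (simp add: orthogonal_def)
    then show "norm (u + w - w) \<le> norm (x - w)"
      unfolding eq using norm_add_orthogonal(1) by simp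
  qed
qed

text \<open>For the component \<open>x'\<close> of \<open>x\<close> in \<open>L\<close>, the
  displacement under both reflections is \<open>2 *\<^sub>R (p - s)\<close>, and
  \<open>p - s\<close> is the sum of the proximal normals \<open>x' - p\<close> and
  \<open>r - s\<close>, both in \<open>V\<close>. The angle bound prevents cancellation, so a short
  displacement puts \<open>x'\<close> close to both sets, and regularity of the pair puts it close
  to their intersection.\<close>

lemma reflections_coercive:
  fixes A B :: "'a::euclidean_space set"
  assumes "closed A" "closed B" "superregular_at A w" "w \<in> A" "w \<in> B" "0 < \<alpha>"
    and "affine_hull_regular_at A B w"
    and L: "L = affine hull (A \<union> B)"
  shows "\<exists>\<nu>>0. \<exists>\<delta>>0. \<forall>x\<in>cball w \<delta>. \<forall>y\<in>relaxed_operator \<alpha> 2 A 2 B x.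
       \<nu> * infdist x ((A \<inter> B) + orthogonal_comp (minkowski_diff L L)) \<le> norm (x - y)"
proof -
  have sub: "A \<subseteq> L" "B \<subseteq> L" unfolding L using hull_subset[of "A \<union> B" affine] by auto
  have wL: "w \<in> L" using assms sub by auto
  have affL: "affine L" by (simp add: L)
  define V where "V = (\<lambda>x. x - w) ` L"
  have V: "subspace V" unfolding V_def using affine_diffs_subspace_subtract[OF affL wL] .
  have VL: "minkowski_diff L L = V"
    using minkowski_diff_affine_hull wL unfolding L V_def by blast
  have in_V: "x - w \<in> V" if "x \<in> L" for x using that by (simp add: V_def)
  obtain \<theta> d1 where th: "\<theta> > 0" and d1: "d1 > 0" and
    angle: "\<forall>a\<in>A \<inter> cball w d1. \<forall>b\<in>B \<inter> cball w d1.
     \<forall>u\<in>proximal_normal_cone A a \<inter> V. \<forall>v\<in>proximal_normal_cone B b \<inter> V.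
       \<theta> * (norm u + norm v) \<le> norm (u + v)"
    using affine_hull_regular_angle[OF assms(7,4) V_def[unfolded L]] by blast
  have "x - w \<in> V" if "x \<in> A \<union> B" for x using that sub in_V by auto
  from angle_imp_local_regularity[OF assms(1,2,4,5,3) th d1 V this angle]
  obtain d2 \<kappa> where d2: "d2 > 0" and kap: "\<kappa> > 0" and
    reg: "\<forall>x\<in>cball w d2. infdist x (A \<inter> B) \<le> \<kappa> * (infdist x A + infdist x B)"
    by blast
  \<comment> \<open>\<open>p\<close> is within \<open>2 * \<delta>\<close> of \<open>w\<close>,
    \<open>r\<close> within \<open>3 * \<delta>\<close>, and so \<open>s\<close> within
    \<open>6 * \<delta>\<close>.\<close>
  define \<delta> where "\<delta> = min d2 (d1 / 6)"
  have del: "\<delta> > 0" "\<delta> \<le> d2" "6 * \<delta> \<le> d1" using d1 d2 by (auto simp: \<delta>_def)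
  \<comment> \<open>\<open>norm (x' - p)\<close> counts once in the distance to \<open>A\<close> and
    once in that to \<open>B\<close>, hence 2/\<theta>; the 1 is the remaining stretch from
    \<open>p\<close> to \<open>s\<close>.\<close>
  define M where "M = \<kappa> * (2 / \<theta> + 1)"
  have M: "M > 0" using kap th by (auto simp: M_def intro!: mult_pos_pos add_pos_pos)
  have "2 * \<alpha> / M * infdist x ((A \<inter> B) + orthogonal_comp (minkowski_diff L L)) \<le> norm (x - y)"
    if x: "x \<in> cball w \<delta>" and y: "y \<in> relaxed_operator \<alpha> 2 A 2 B x" for x y
  proof -
    obtain x' v where xv: "x = x' + v" and x'L: "x' \<in> L" and v: "v \<in> orthogonal_comp V"
      and "norm (x' - w) \<le> norm (x - w)"
      using affine_orthogonal_decomposition[OF affL wL, of x] unfolding V_def by metis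
    then have x'w: "norm (x' - w) \<le> \<delta>" using x by (simp add: dist_norm norm_minus_commute)
    \<comment> \<open>Translation invariance removes the component of \<open>x\<close> orthogonal to
      \<open>L\<close>; the angle bound applies only to normals in \<open>V\<close>.\<close>
    have "y - v \<in> relaxed_operator \<alpha> 2 A 2 B (x + - v)"
      using relaxed_operator_reflections_translate[OF sub _ y, of "- v"] v
      by (simp add: VL orthogonal_comp_uminus)
    then obtain r q where r: "r \<in> relaxed_projector 2 A x'" and q: "q \<in> relaxed_projector 2 B r"
      and yv: "y - v = x' - \<alpha> *\<^sub>R (x' - q)"
      unfolding xv by (auto elim: relaxed_operatorE)
    obtain p where p: "p \<in> projector A x'" "r = x' - 2 *\<^sub>R (x' - p)"
      using r by (rule relaxed_projectorE)
    obtain s where s: "s \<in> projector B r" "q = r - 2 *\<^sub>R (r - s)"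
      using q by (rule relaxed_projectorE)
    have mem: "p \<in> A" "s \<in> B" using p s by (auto simp: projector_iff)
    have pw: "norm (p - w) \<le> 2 * \<delta>" using projector_dist_le[OF p(1) \<open>w \<in> A\<close>] x'w by simp
    have "norm (r - w) \<le> 3 * \<delta>"
      using relaxed_projector_dist_le[OF r \<open>w \<in> A\<close>] x'w by simp
    then have sw: "norm (s - w) \<le> 6 * \<delta>" using projector_dist_le[OF s(1) \<open>w \<in> B\<close>] by simp
    have wV: "x' - w \<in> V" "p - w \<in> V" "s - w \<in> V" using x'L mem sub in_V by auto
    have u: "x' - p \<in> V" using subspace_diff[OF V wV(1,2)] by simp
    have "r - s = (p - w) - (x' - p) - (s - w)" using p by (simp add: scaleR_2)
    then have rs: "r - s \<in> V" using subspace_diff[OF V subspace_diff[OF V wV(2) u] wV(3)] by simp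
    have ps: "(x' - p) + (r - s) = p - s" using p by (simp add: scaleR_2)
    have "\<theta> * (norm (x' - p) + norm (r - s)) \<le> norm ((x' - p) + (r - s))"
    proof -
      have "p \<in> A \<inter> cball w d1" "s \<in> B \<inter> cball w d1"
        using mem pw sw del by (auto simp: dist_norm norm_minus_commute)
      moreover have "x' - p \<in> proximal_normal_cone A p \<inter> V" "r - s \<in> proximal_normal_cone B s \<inter> V"
        using u rs projector_proximal_normal p(1) s(1) by auto
      ultimately show ?thesis using angle by blast
    qed
    moreover have "\<theta> * norm (x' - p) \<le> \<theta> * (norm (x' - p) + norm (r - s))"
      using th by (intro mult_left_mono) auto
    ultimately have "\<theta> * norm (x' - p) \<le> norm (p - s)" unfolding ps by linarith
    then have dA: "norm (x' - p) \<le> norm (p - s) / \<theta>" using th by (simp add: field_simps)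
    have "infdist x' B \<le> norm (x' - s)" using infdist_le[OF mem(2), of x'] by (simp add: dist_norm)
    also have "\<dots> \<le> norm (x' - p) + norm (p - s)"
      using norm_triangle_ineq[of "x' - p" "p - s"] by simp
    finally have "infdist x' A + infdist x' B \<le> 2 * (norm (p - s) / \<theta>) + norm (p - s)"
      using dA projector_norm[OF p(1)] by linarith
    then have "\<kappa> * (infdist x' A + infdist x' B) \<le> \<kappa> * (2 * (norm (p - s) / \<theta>) + norm (p - s))"
      using kap by (intro mult_left_mono) auto
    also have "\<dots> = M * norm (p - s)" by (simp add: M_def algebra_simps)
    finally have "infdist x' (A \<inter> B) \<le> M * norm (p - s)"
      using reg[rule_format, of x'] x'w del by (auto simp: dist_norm norm_minus_commute)
    \<comment> \<open>The point of the intersection nearest to \<open>x'\<close>, shifted by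
      \<open>v\<close>, lies in the sum and is as far from \<open>x\<close> as the original from
      \<open>x'\<close>.\<close>
    moreover have "infdist x ((A \<inter> B) + orthogonal_comp V) \<le> infdist x' (A \<inter> B)"
    proof -
      obtain z where z: "z \<in> projector (A \<inter> B) x'"
        using projector_nonempty[of "A \<inter> B" x'] assms by auto
      then have "z + v \<in> (A \<inter> B) + orthogonal_comp V"
        using v by (auto simp: projector_iff)
      then have "infdist x ((A \<inter> B) + orthogonal_comp V) \<le> dist x (z + v)"
        by (rule infdist_le)
      then show ?thesis using projector_norm[OF z] by (simp add: xv dist_norm)
    qed
    ultimately have "infdist x ((A \<inter> B) + orthogonal_comp V) \<le> M * norm (p - s)" by linarith
    then have "2 * \<alpha> / M * infdist x ((A \<inter> B) + orthogonal_comp V) \<le> 2 * \<alpha> / M * (M * norm (p - s))"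
      using M assms by (intro mult_left_mono) auto
    also have "\<dots> = 2 * \<alpha> * norm (p - s)" using M by simp
    also have "\<dots> = norm (x - y)"
    proof -
      have "x' - q = 2 *\<^sub>R (p - s)" using p s by (simp add: scaleR_2)
      moreover have "x - y = \<alpha> *\<^sub>R (x' - q)" using yv xv by (simp add: algebra_simps)
      ultimately have "norm (x - y) = \<bar>\<alpha>\<bar> * (2 * norm (p - s))" by (simp add: abs_mult)
      then show ?thesis using assms by simp
    qed
    finally show ?thesis unfolding VL .
  qed
  moreover have "2 * \<alpha> / M > 0" using M assms by simp
  ultimately show ?thesis using del(1) by blast
qed

section \<open>Convergence of cyclic sequences\<close>

lemma geometric_steps_converge:
  fixes y :: "nat \<Rightarrow> 'a::banach"
  assumes step: "\<And>k. norm (y (Suc k) - y k) \<le> K * \<rho> ^ k" and "0 \<le> \<rho>" "\<rho> < 1" "0 \<le> K"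
  obtains l where "y \<longlonglongrightarrow> l" "\<And>k. norm (y k - l) \<le> K / (1 - \<rho>) * \<rho> ^ k"
proof -
  have tail: "norm (y (k + n) - y k) \<le> K / (1 - \<rho>) * \<rho> ^ k" for k n
  proof -
    have "norm (y (k + n) - y k) \<le> (\<Sum>i<n. norm (y (Suc (k + i)) - y (k + i)))"
    proof (induction n)
      case (Suc n)
      have "norm (y (k + Suc n) - y k) \<le> norm (y (Suc (k + n)) - y (k + n)) + norm (y (k + n) - y k)"
        using norm_triangle_ineq[of "y (Suc (k + n)) - y (k + n)" "y (k + n) - y k"] by simp
      then show ?case using Suc by simp
    qed simp
    also have "\<dots> \<le> (\<Sum>i<n. K * \<rho> ^ k * \<rho> ^ i)"
      using step by (intro sum_mono) (metis mult.assoc power_add)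
    also have "\<dots> = K * \<rho> ^ k * (\<Sum>i<n. \<rho> ^ i)" by (simp add: sum_distrib_left)
    also have "\<dots> \<le> K * \<rho> ^ k * (1 / (1 - \<rho>))"
      using assms by (intro mult_left_mono) (auto simp: sum_gp_strict divide_right_mono)
    finally show ?thesis by simp
  qed
  have "summable (\<lambda>k. K * \<rho> ^ k)"
    using assms by (intro summable_mult summable_geometric) simp
  then have "summable (\<lambda>k. y (Suc k) - y k)"
    by (rule summable_comparison_test') (rule step)
  then have "convergent (\<lambda>n. \<Sum>k<n. y (Suc k) - y k)"
    by (simp add: summable_iff_convergent)
  then have "convergent (\<lambda>n. y n - y 0)" by (simp add: sum_lessThan_telescope)
  then obtain d where "(\<lambda>n. y n - y 0) \<longlonglongrightarrow> d" by (auto simp: convergent_def)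
  from tendsto_add[OF this tendsto_const[of "y 0"]] have lim: "y \<longlonglongrightarrow> d + y 0" by simp
  moreover have "norm (y k - (d + y 0)) \<le> K / (1 - \<rho>) * \<rho> ^ k" for k
  proof -
    have "(\<lambda>n. norm (y (n + k) - y k)) \<longlonglongrightarrow> norm ((d + y 0) - y k)"
      by (intro tendsto_intros LIMSEQ_ignore_initial_segment lim)
    then have "norm ((d + y 0) - y k) \<le> K / (1 - \<rho>) * \<rho> ^ k"
      using tail[of k] by (intro LIMSEQ_le_const2) (auto simp: add.commute)
    then show ?thesis by (simp add: norm_minus_commute)
  qed
  ultimately show ?thesis by (rule that)
qed

text \<open>The rate per index is the \<open>l\<close>-th root of the rate per block; dividing by
  \<rho> pays for the incomplete last block.\<close>

lemma geometric_blocks_R_linear: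
  assumes "0 < l" "0 < \<rho>" "\<rho> < 1" "0 \<le> G" and "\<And>n. norm (x n - c) \<le> G * \<rho> ^ (n div l)"
  shows "R_linearly_convergent x c"
proof -
  define r where "r = root l \<rho>"
  have r: "0 < r" "r < 1" "r ^ l = \<rho>"
    using assms by (auto simp: r_def real_root_gt_zero)
  have "norm (x n - c) \<le> G / \<rho> * r ^ n" for n
  proof -
    have "\<rho> ^ (n div l) * \<rho> = r ^ (l * (n div l)) * r ^ l" using r by (simp add: power_mult)
    also have "\<dots> \<le> r ^ (l * (n div l)) * r ^ (n mod l)"
      using r assms(1) by (intro mult_left_mono power_decreasing) (auto simp: less_imp_le)
    also have "\<dots> = r ^ n" by (simp flip: power_add)
    finally have "\<rho> ^ (n div l) \<le> r ^ n / \<rho>" using assms by (simp add: pos_le_divide_eq)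
    then have "G * \<rho> ^ (n div l) \<le> G * (r ^ n / \<rho>)" using assms by (intro mult_left_mono) auto
    then show ?thesis using assms(5)[of n] by simp
  qed
  moreover have "0 \<le> G / \<rho>" using assms by simp
  ultimately show ?thesis
    unfolding R_linearly_convergent_def using r by (intro exI[of _ r] exI[of _ "G / \<rho>"]) auto
qed

section \<open>Common constants and the contraction over one cycle\<close>

text \<open>Serves to choose decrease constants, coercivity constants and radii common to all
  operators: each may be lowered, so a minimum over the finite index set works.\<close>

lemma finite_uniform_pos:
  fixes P :: "'i \<Rightarrow> real \<Rightarrow> bool"
  assumes "finite J" "\<And>j. j \<in> J \<Longrightarrow> \<exists>b>0. P j b"
    and "\<And>j b b'. \<lbrakk>P j b; 0 < b'; b' \<le> b\<rbrakk> \<Longrightarrow> P j b'"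
  shows "\<exists>b>0. \<forall>j\<in>J. P j b"
  using assms(1,2)
proof (induction J)
  case empty
  then show ?case using zero_less_one by blast
next
  case (insert j J)
  then obtain b c where "b > 0" "\<forall>j\<in>J. P j b" "c > 0" "P j c" by blast
  then show ?case
    using assms(3) by (intro exI[of _ "min b c"]) (auto simp: min_less_iff_conj)
qed

text \<open>Sum the Fejer inequalities along the cycle at the point \<open>z\<close> of
  \<open>S\<close> nearest to \<open>y 0\<close>. Coercivity at each iterate, together with the path
  back to \<open>y 0\<close>, bounds the distance from \<open>y 0\<close> to every
  \<open>Z j\<close> by a multiple of the path length, so regularity makes the summed decrease at
  least a fixed fraction of the squared distance to \<open>S\<close>.\<close>

lemma cycle_step:
  fixes y :: "nat \<Rightarrow> 'a::euclidean_space"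
  assumes "0 < l" "0 < \<beta>" "0 < \<nu>" "0 < \<kappa>" "0 \<le> \<epsilon>" "\<epsilon> \<le> 3"
    and fejer: "\<forall>j\<in>{1..l}. \<forall>x\<in>cball w \<delta>. \<forall>z\<in>Z j \<inter> cball w \<delta>. \<forall>y\<in>T j x.
       (norm (y - z))\<^sup>2 \<le> (1 + \<epsilon>) * (norm (x - z))\<^sup>2 - \<beta> * (norm (x - y))\<^sup>2"
    and coercive: "\<forall>j\<in>{1..l}. \<forall>x\<in>cball w \<delta>. \<forall>y\<in>T j x. \<nu> * infdist x (Z j) \<le> norm (x - y)"
    and regular: "\<forall>x\<in>cball w \<delta>. infdist x S \<le> \<kappa> * Max ((\<lambda>j. infdist x (Z j)) ` {1..l})"
    and S: "S = (\<Inter>j\<in>{1..l}. Z j)" "closed S" "w \<in> S"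
    and y: "\<And>i. i < l \<Longrightarrow> y (Suc i) \<in> T (i + 1) (y i)"
    and near: "(2 ^ l + 2) * norm (y 0 - w) \<le> \<delta>"
    and "i \<le> l"
  shows "norm (y i - y 0) \<le> (2 ^ l + 1) * infdist (y 0) S" (is ?move)
    and "(infdist (y l) S)\<^sup>2 \<le>
      ((1 + \<epsilon>) ^ l - \<beta> / (l * (\<kappa> * (1 / \<nu> + 1))\<^sup>2)) * (infdist (y 0) S)\<^sup>2" (is ?contract)
proof -
  define d where "d = infdist (y 0) S"
  obtain z where z: "z \<in> projector S (y 0)" using projector_nonempty[of S "y 0"] S by auto
  have zS: "z \<in> S" using z by (simp add: projector_iff)
  have zd: "norm (y 0 - z) = d" using projector_norm[OF z] by (simp add: d_def)
  have d0: "0 \<le> d" by (simp add: d_def infdist_nonneg)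
  have dw: "d \<le> norm (y 0 - w)" using infdist_le[OF S(3), of "y 0"] by (simp add: d_def dist_norm)
  have zw: "norm (z - w) \<le> 2 * norm (y 0 - w)" by (rule projector_dist_le[OF z S(3)])
  have "2 * norm (y 0 - w) \<le> (2 ^ l + 2) * norm (y 0 - w)" by (intro mult_right_mono) auto
  then have "z \<in> cball w \<delta>" using zw near by (simp add: dist_norm norm_minus_commute)
  then have zZ: "z \<in> Z j \<inter> cball w \<delta>" if "j \<in> {1..l}" for j using zS S(1) that by auto
  let ?s = "\<lambda>k. norm (y k - y (Suc k))"
  \<comment> \<open>The factor \<open>2 ^ l + 2\<close> in the hypothesis combines the growth of the
    distance to \<open>z\<close> with the distance from \<open>z\<close> to
    \<open>w\<close>.\<close>
  have near_i: "y i \<in> cball w \<delta>" if "norm (y i - z) \<le> 2 ^ i * d" "i \<le> l" for i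
  proof -
    have "(2::real) ^ i * d \<le> 2 ^ l * norm (y 0 - w)"
      using that dw d0 by (intro mult_mono power_increasing) auto
    then have "norm (y i - w) \<le> (2 ^ l + 2) * norm (y 0 - w)"
      using norm_triangle_ineq[of "y i - z" "z - w"] zw that by (simp add: distrib_right)
    then show ?thesis using near by (simp add: dist_norm norm_minus_commute)
  qed
  \<comment> \<open>The crude doubling bound keeps the iterates where the Fejer inequality applies;
    it uses that \<open>1 + \<epsilon>\<close> is at most 4. The second bound accumulates the
    decrease, whose earlier terms are kept only with factor 1.\<close>
  have inv: "norm (y i - z) \<le> 2 ^ i * d \<and>
      (norm (y i - z))\<^sup>2 \<le> (1 + \<epsilon>) ^ i * d\<^sup>2 - \<beta> * (\<Sum>k<i. (?s k)\<^sup>2)" if "i \<le> l" for i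
    using that
  proof (induction i)
    case 0
    then show ?case by (simp add: zd)
  next
    case (Suc i)
    then have IH: "norm (y i - z) \<le> 2 ^ i * d"
      "(norm (y i - z))\<^sup>2 \<le> (1 + \<epsilon>) ^ i * d\<^sup>2 - \<beta> * (\<Sum>k<i. (?s k)\<^sup>2)" and il: "i < l" by auto
    have "i + 1 \<in> {1..l}" using il by simp
    then have F: "(norm (y (Suc i) - z))\<^sup>2 \<le> (1 + \<epsilon>) * (norm (y i - z))\<^sup>2 - \<beta> * (?s i)\<^sup>2"
      using fejer near_i[OF IH(1)] zZ y[OF il] il by (meson less_imp_le)
    have "(1 + \<epsilon>) * (norm (y i - z))\<^sup>2 \<le> 4 * (norm (y i - z))\<^sup>2"
      using assms by (intro mult_right_mono) auto
    moreover have "0 \<le> \<beta> * (?s i)\<^sup>2" using assms by simp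
    ultimately have "(norm (y (Suc i) - z))\<^sup>2 \<le> (2 * norm (y i - z))\<^sup>2"
      using F by (simp add: power_mult_distrib)
    then have "norm (y (Suc i) - z) \<le> 2 * norm (y i - z)" by (rule power2_le_imp_le) simp
    then have 1: "norm (y (Suc i) - z) \<le> 2 ^ Suc i * d" using IH(1) by simp
    have "(1 + \<epsilon>) * (norm (y i - z))\<^sup>2 \<le> (1 + \<epsilon>) * ((1 + \<epsilon>) ^ i * d\<^sup>2 - \<beta> * (\<Sum>k<i. (?s k)\<^sup>2))"
      using IH(2) assms by (intro mult_left_mono) auto
    also have "\<dots> = (1 + \<epsilon>) ^ Suc i * d\<^sup>2 - (1 + \<epsilon>) * (\<beta> * (\<Sum>k<i. (?s k)\<^sup>2))"
      by (simp add: right_diff_distrib mult.assoc)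
    also have "\<dots> \<le> (1 + \<epsilon>) ^ Suc i * d\<^sup>2 - 1 * (\<beta> * (\<Sum>k<i. (?s k)\<^sup>2))"
      using assms by (intro diff_left_mono mult_right_mono) (auto intro!: mult_nonneg_nonneg sum_nonneg)
    finally have "(norm (y (Suc i) - z))\<^sup>2 \<le>
        (1 + \<epsilon>) ^ Suc i * d\<^sup>2 - \<beta> * (\<Sum>k<Suc i. (?s k)\<^sup>2)"
      using F by (simp add: distrib_left)
    then show ?case using 1 by blast
  qed
  show ?move
  proof -
    have "(2::real) ^ i * d \<le> 2 ^ l * d"
      using \<open>i \<le> l\<close> d0 by (intro mult_right_mono power_increasing) auto
    then show ?thesis
      using inv[OF \<open>i \<le> l\<close>] norm_triangle_ineq4[of "y i - z" "y 0 - z"] zd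
      by (simp add: d_def[symmetric] distrib_right)
  qed
  define \<sigma> where "\<sigma> = (\<Sum>k<l. ?s k)"
  have path: "norm (y 0 - y i) \<le> (\<Sum>k<i. ?s k)" for i
  proof (induction i)
    case (Suc i)
    then show ?case using norm_triangle_ineq[of "y 0 - y i" "y i - y (Suc i)"] by simp
  qed simp
  have "infdist (y 0) (Z j) \<le> (1 / \<nu> + 1) * \<sigma>" if j: "j \<in> {1..l}" for j
  proof -
    \<comment> \<open>Operators are numbered from 1 and iterates from 0, so \<open>T j\<close> acts
      on \<open>y (j - 1)\<close>.\<close>
    obtain i where i: "j = i + 1" "i < l" using j by (metis Suc_eq_plus1 atLeastAtMost_iff le_add_diff_inverse2 less_eq_Suc_le)
    have "y i \<in> cball w \<delta>" using near_i inv i by auto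
    then have "\<nu> * infdist (y i) (Z j) \<le> ?s i"
      using coercive j y[OF i(2)] unfolding i(1) by blast
    also have "?s i \<le> \<sigma>"
      unfolding \<sigma>_def using i by (intro member_le_sum) auto
    finally have "infdist (y i) (Z j) \<le> 1 / \<nu> * \<sigma>"
      using assms by (simp add: field_simps)
    moreover have "norm (y 0 - y i) \<le> \<sigma>"
    proof -
      have "(\<Sum>k<i. ?s k) \<le> \<sigma>"
        unfolding \<sigma>_def using i by (intro sum_mono2) auto
      then show ?thesis using path[of i] by linarith
    qed
    moreover have "infdist (y 0) (Z j) \<le> infdist (y i) (Z j) + norm (y 0 - y i)"
      using infdist_triangle[of "y 0" "Z j" "y i"] by (simp add: dist_norm)
    ultimately show ?thesis by (simp add: distrib_right)
  qed
  then have "Max ((\<lambda>j. infdist (y 0) (Z j)) ` {1..l}) \<le> (1 / \<nu> + 1) * \<sigma>"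
    using assms(1) by (subst Max_le_iff) auto
  then have "\<kappa> * Max ((\<lambda>j. infdist (y 0) (Z j)) ` {1..l}) \<le> \<kappa> * ((1 / \<nu> + 1) * \<sigma>)"
    using assms by (intro mult_left_mono) auto
  moreover have "y 0 \<in> cball w \<delta>" using near_i[of 0] zd by simp
  ultimately have "d \<le> \<kappa> * (1 / \<nu> + 1) * \<sigma>"
    using regular unfolding d_def by fastforce
  then have "d\<^sup>2 \<le> (\<kappa> * (1 / \<nu> + 1) * \<sigma>)\<^sup>2" using d0 by (intro power_mono) auto
  also have "\<dots> = (\<kappa> * (1 / \<nu> + 1))\<^sup>2 * \<sigma>\<^sup>2" by (simp add: power_mult_distrib)
  also have "\<dots> \<le> (\<kappa> * (1 / \<nu> + 1))\<^sup>2 * (l * (\<Sum>k<l. (?s k)\<^sup>2))"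
  proof (intro mult_left_mono)
    \<comment> \<open>Cauchy-Schwarz turns the path length into the sum of squared steps; this is
      the source of the factor \<open>l\<close>.\<close>
    show "\<sigma>\<^sup>2 \<le> l * (\<Sum>k<l. (?s k)\<^sup>2)"
      using sum_squared_le_sum_of_squares[of ?s "{..<l}"] by (simp add: \<sigma>_def mult.commute)
  qed simp
  finally have d2: "d\<^sup>2 \<le> (l * (\<kappa> * (1 / \<nu> + 1))\<^sup>2) * (\<Sum>k<l. (?s k)\<^sup>2)"
    by (simp add: mult_ac)
  define Q where "Q = l * (\<kappa> * (1 / \<nu> + 1))\<^sup>2"
  have Q: "Q > 0" unfolding Q_def using assms(1,3,4)
    by (intro mult_pos_pos zero_less_power add_pos_pos) auto
  have "\<beta> / Q * d\<^sup>2 \<le> \<beta> / Q * (Q * (\<Sum>k<l. (?s k)\<^sup>2))"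
    using d2 Q assms by (intro mult_left_mono) (auto simp: Q_def)
  also have "\<dots> = \<beta> * (\<Sum>k<l. (?s k)\<^sup>2)" using Q by simp
  finally have "(norm (y l - z))\<^sup>2 \<le> ((1 + \<epsilon>) ^ l - \<beta> / Q) * d\<^sup>2"
    using inv[of l] by (simp add: left_diff_distrib)
  moreover have "(infdist (y l) S)\<^sup>2 \<le> (norm (y l - z))\<^sup>2"
    using infdist_le[OF zS, of "y l"] infdist_nonneg by (intro power_mono) (auto simp: dist_norm)
  ultimately show ?contract by (simp add: Q_def d_def)
qed

text \<open>The order of choices matters: \<beta>, \<nu> and \<kappa> fix the gain of a cycle, and
  only then is \<epsilon> taken so small that the accumulated error consumes at most half of it.
  This is possible since \<beta> does not depend on \<epsilon>.\<close>

lemma cyclic_quasi_fejer_converges: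
  fixes T :: "nat \<Rightarrow> 'a::euclidean_space \<Rightarrow> 'a set"
  assumes "0 < l" and Z: "\<And>j. j \<in> {1..l} \<Longrightarrow> closed (Z j)" "\<And>j. j \<in> {1..l} \<Longrightarrow> w \<in> Z j"
    and regular: "linearly_regular_around {1..l} Z w"
    and fejer: "\<And>j. j \<in> {1..l} \<Longrightarrow> \<exists>\<beta>>0. \<forall>\<epsilon>>0. \<exists>\<delta>>0. \<forall>x\<in>cball w \<delta>. \<forall>z\<in>Z j \<inter> cball w \<delta>.
      \<forall>y\<in>T j x. (norm (y - z))\<^sup>2 \<le> (1 + \<epsilon>) * (norm (x - z))\<^sup>2 - \<beta> * (norm (x - y))\<^sup>2"
    and coercive: "\<And>j. j \<in> {1..l} \<Longrightarrow> \<exists>\<nu>>0. \<exists>\<delta>>0. \<forall>x\<in>cball w \<delta>. \<forall>y\<in>T j x.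
      \<nu> * infdist x (Z j) \<le> norm (x - y)"
  shows "\<exists>r>0. \<forall>x. cyclic_sequence l T x \<and> x 0 \<in> cball w r \<longrightarrow>
    (\<exists>xbar. R_linearly_convergent x xbar \<and> xbar \<in> (\<Inter>j\<in>{1..l}. Z j))"
proof -
  define S where "S = (\<Inter>j\<in>{1..l}. Z j)"
  have S: "closed S" "w \<in> S" using Z by (auto simp: S_def)
  have "\<exists>\<beta>>0. \<forall>j\<in>{1..l}. \<forall>\<epsilon>>0. \<exists>\<delta>>0. \<forall>x\<in>cball w \<delta>. \<forall>z\<in>Z j \<inter> cball w \<delta>.
      \<forall>y\<in>T j x. (norm (y - z))\<^sup>2 \<le> (1 + \<epsilon>) * (norm (x - z))\<^sup>2 - \<beta> * (norm (x - y))\<^sup>2"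
  proof (rule finite_uniform_pos[OF _ fejer])
    fix j b b' assume b: "0 < (b'::real)" "b' \<le> b"
      and *: "\<forall>\<epsilon>>0. \<exists>\<delta>>0. \<forall>x\<in>cball w \<delta>. \<forall>z\<in>Z j \<inter> cball w \<delta>.
      \<forall>y\<in>T j x. (norm (y - z))\<^sup>2 \<le> (1 + \<epsilon>) * (norm (x - z))\<^sup>2 - b * (norm (x - y))\<^sup>2"
    have "v \<le> u - b' * (norm (x - y))\<^sup>2" if "v \<le> u - b * (norm (x - y))\<^sup>2" for u v and x y :: 'a
      using that mult_right_mono[OF b(2), of "(norm (x - y))\<^sup>2"] by simp
    then show "\<forall>\<epsilon>>0. \<exists>\<delta>>0. \<forall>x\<in>cball w \<delta>. \<forall>z\<in>Z j \<inter> cball w \<delta>.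
      \<forall>y\<in>T j x. (norm (y - z))\<^sup>2 \<le> (1 + \<epsilon>) * (norm (x - z))\<^sup>2 - b' * (norm (x - y))\<^sup>2"
      using * by meson
  qed auto
  then obtain \<beta> where beta: "\<beta> > 0" and F: "\<forall>j\<in>{1..l}. \<forall>\<epsilon>>0. \<exists>\<delta>>0. \<forall>x\<in>cball w \<delta>. \<forall>z\<in>Z j \<inter> cball w \<delta>.
      \<forall>y\<in>T j x. (norm (y - z))\<^sup>2 \<le> (1 + \<epsilon>) * (norm (x - z))\<^sup>2 - \<beta> * (norm (x - y))\<^sup>2"
    by blast
  have "\<exists>\<nu>>0. \<forall>j\<in>{1..l}. \<exists>\<delta>>0. \<forall>x\<in>cball w \<delta>. \<forall>y\<in>T j x. \<nu> * infdist x (Z j) \<le> norm (x - y)"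
  proof (rule finite_uniform_pos[OF _ coercive])
    fix j b b' assume b: "0 < (b'::real)" "b' \<le> b"
      and *: "\<exists>\<delta>>0. \<forall>x\<in>cball w \<delta>. \<forall>y\<in>T j x. b * infdist x (Z j) \<le> norm (x - y)"
    have "b' * infdist x (Z j) \<le> b * infdist x (Z j)" for x
      using b by (intro mult_right_mono infdist_nonneg)
    then show "\<exists>\<delta>>0. \<forall>x\<in>cball w \<delta>. \<forall>y\<in>T j x. b' * infdist x (Z j) \<le> norm (x - y)"
      using * by (meson order_trans)
  qed auto
  then obtain \<nu> where nu: "\<nu> > 0" and
    N: "\<And>j. j \<in> {1..l} \<Longrightarrow> \<exists>\<delta>>0. \<forall>x\<in>cball w \<delta>. \<forall>y\<in>T j x. \<nu> * infdist x (Z j) \<le> norm (x - y)"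
    by blast
  have "\<exists>\<delta>>0. \<forall>j\<in>{1..l}. \<forall>x\<in>cball w \<delta>. \<forall>y\<in>T j x. \<nu> * infdist x (Z j) \<le> norm (x - y)"
    by (rule finite_uniform_pos[OF _ N]) auto
  then obtain d1 where d1: "d1 > 0" and
    C: "\<forall>j\<in>{1..l}. \<forall>x\<in>cball w d1. \<forall>y\<in>T j x. \<nu> * infdist x (Z j) \<le> norm (x - y)"
    by blast
  obtain d2 \<kappa> where d2: "d2 > 0" and kap: "\<kappa> > 0" and
    R: "\<forall>x\<in>cball w d2. infdist x S \<le> \<kappa> * Max ((\<lambda>j. infdist x (Z j)) ` {1..l})"
    using regular unfolding linearly_regular_around_def S_def by blast
  \<comment> \<open>A lower bound for the gain of one cycle, capped at 1 so that
    \<open>1 - g / 2\<close> is positive.\<close>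
  define g where "g = min 1 (\<beta> / (l * (\<kappa> * (1 / \<nu> + 1))\<^sup>2))"
  have "l * (\<kappa> * (1 / \<nu> + 1))\<^sup>2 > 0"
    using kap nu \<open>0 < l\<close> by (intro mult_pos_pos zero_less_power add_pos_pos) auto
  then have g: "0 < g" "g \<le> 1" "g \<le> \<beta> / (l * (\<kappa> * (1 / \<nu> + 1))\<^sup>2)"
    using beta by (auto simp: g_def)
  \<comment> \<open>The root makes the error of a whole cycle at most \<open>g / 2\<close>, which
    leaves the contraction factor \<open>1 - g / 2\<close> for squared distances.\<close>
  define \<epsilon> where "\<epsilon> = min 3 (root l (1 + g / 2) - 1)"
  have "root l (1 + g / 2) > 1" using g \<open>0 < l\<close> by (simp add: real_root_gt_1_iff)
  then have eps: "0 < \<epsilon>" "\<epsilon> \<le> 3" "1 + \<epsilon> \<le> root l (1 + g / 2)" by (auto simp: \<epsilon>_def)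
  have "(1 + \<epsilon>) ^ l \<le> root l (1 + g / 2) ^ l" using eps by (intro power_mono) auto
  also have "\<dots> = 1 + g / 2" using g \<open>0 < l\<close> by simp
  finally have eps_l: "(1 + \<epsilon>) ^ l \<le> 1 + g / 2" .
  define \<rho> where "\<rho> = sqrt (1 - g / 2)"
  have rho: "0 < \<rho>" "\<rho> < 1" "\<rho>\<^sup>2 = 1 - g / 2" using g by (auto simp: \<rho>_def)
  have "\<exists>\<delta>>0. \<forall>j\<in>{1..l}. \<forall>x\<in>cball w \<delta>. \<forall>z\<in>Z j \<inter> cball w \<delta>.
      \<forall>y\<in>T j x. (norm (y - z))\<^sup>2 \<le> (1 + \<epsilon>) * (norm (x - z))\<^sup>2 - \<beta> * (norm (x - y))\<^sup>2"
    by (rule finite_uniform_pos) (use F eps in auto)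
  then obtain d3 where d3: "d3 > 0" and F3: "\<forall>j\<in>{1..l}. \<forall>x\<in>cball w d3. \<forall>z\<in>Z j \<inter> cball w d3.
      \<forall>y\<in>T j x. (norm (y - z))\<^sup>2 \<le> (1 + \<epsilon>) * (norm (x - z))\<^sup>2 - \<beta> * (norm (x - y))\<^sup>2"
    by blast
  define \<delta> where "\<delta> = min d1 (min d2 d3)"
  have del: "\<delta> > 0" "\<delta> \<le> d1" "\<delta> \<le> d2" "\<delta> \<le> d3" using d1 d2 d3 by (auto simp: \<delta>_def)
  have cb: "cball w \<delta> \<subseteq> cball w d1" "cball w \<delta> \<subseteq> cball w d2" "cball w \<delta> \<subseteq> cball w d3"
    using del by auto
  have F': "\<forall>j\<in>{1..l}. \<forall>x\<in>cball w \<delta>. \<forall>z\<in>Z j \<inter> cball w \<delta>. \<forall>y\<in>T j x.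
       (norm (y - z))\<^sup>2 \<le> (1 + \<epsilon>) * (norm (x - z))\<^sup>2 - \<beta> * (norm (x - y))\<^sup>2"
    using F3 cb(3) by blast
  have C': "\<forall>j\<in>{1..l}. \<forall>x\<in>cball w \<delta>. \<forall>y\<in>T j x. \<nu> * infdist x (Z j) \<le> norm (x - y)"
    using C cb(1) by blast
  have R': "\<forall>x\<in>cball w \<delta>. infdist x S \<le> \<kappa> * Max ((\<lambda>j. infdist x (Z j)) ` {1..l})"
    using R cb(2) by blast
  define c :: real where "c = 2 ^ l + 1"
  have c: "c > 0" by (simp add: c_def add_pos_pos)
  \<comment> \<open>\<open>r * m\<close> bounds the total drift from \<open>w\<close>: the initial
    distance \<open>r\<close> plus the geometric series of the cycle movements.\<close>
  define m where "m = 1 + c / (1 - \<rho>)"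
  have m: "m > 0" using c rho by (auto simp: m_def intro!: add_pos_pos divide_pos_pos)
  define r where "r = \<delta> / ((2 ^ l + 2) * m)"
  have p2: "(2::real) ^ l + 2 > 0" by (simp add: add_pos_pos)
  have r: "r > 0" "(2 ^ l + 2) * (r * m) = \<delta>" using del m p2 by (auto simp: r_def)
  have "\<exists>xbar. R_linearly_convergent x xbar \<and> xbar \<in> S"
    if cyc: "cyclic_sequence l T x" and x0: "x 0 \<in> cball w r" for x
  proof -
    define a where "a k = infdist (x (k * l)) S" for k
    have a0: "0 \<le> a k" for k by (simp add: a_def infdist_nonneg)
    \<comment> \<open>Every cycle restarts at the operator with index 1, so the one-cycle lemma
      applies to each shifted sequence.\<close>
    have sub: "x (Suc (k * l + i)) \<in> T (i + 1) (x (k * l + i))" if "i < l" for k i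
    proof -
      have "(k * l + i) mod l = i" using that by simp
      then show ?thesis using cyc unfolding cyclic_sequence_def by metis
    qed
    have step: "(\<forall>i\<le>l. norm (x (k * l + i) - x (k * l)) \<le> c * a k) \<and> a (Suc k) \<le> \<rho> * a k"
      if near: "(2 ^ l + 2) * norm (x (k * l) - w) \<le> \<delta>" for k
    proof -
      note cs = cycle_step[OF \<open>0 < l\<close> beta nu kap less_imp_le[OF eps(1)] eps(2) F' C' R' S_def S,
          where y = "\<lambda>i. x (k * l + i)", simplified add_0_right]
      have 1: "norm (x (k * l + i) - x (k * l)) \<le> c * a k" if "i \<le> l" for i
        using cs(1)[OF _ near that] sub unfolding c_def a_def by simp
      have "(infdist (x (k * l + l)) S)\<^sup>2 \<le>
          ((1 + \<epsilon>) ^ l - \<beta> / (l * (\<kappa> * (1 / \<nu> + 1))\<^sup>2)) * (a k)\<^sup>2"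
        using cs(2)[OF _ near order_refl] sub unfolding a_def by simp
      also have "\<dots> \<le> \<rho>\<^sup>2 * (a k)\<^sup>2"
        using eps_l g(3) rho(3) by (intro mult_right_mono) auto
      also have "infdist (x (k * l + l)) S = a (Suc k)" by (simp add: a_def add.commute)
      finally have "(a (Suc k))\<^sup>2 \<le> (\<rho> * a k)\<^sup>2" by (simp add: power_mult_distrib)
      then have "a (Suc k) \<le> \<rho> * a k"
        using rho a0 by (intro power2_le_imp_le[of "a (Suc k)"]) auto
      with 1 show ?thesis by blast
    qed
    have x0w: "norm (x 0 - w) \<le> r" using x0 by (simp add: dist_norm norm_minus_commute)
    have near_bound: "(2 ^ l + 2) * norm (x (k * l) - w) \<le> \<delta>"
      if "norm (x (k * l) - w) \<le> r + c * r * (\<Sum>i<k. \<rho> ^ i)" for k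
    proof -
      have "(\<Sum>i<k. \<rho> ^ i) \<le> 1 / (1 - \<rho>)" using rho by (simp add: sum_gp_strict divide_right_mono)
      then have "c * r * (\<Sum>i<k. \<rho> ^ i) \<le> c * r * (1 / (1 - \<rho>))"
        using c r by (intro mult_left_mono) auto
      then have "norm (x (k * l) - w) \<le> r * m" using that by (simp add: m_def algebra_simps)
      then have "(2 ^ l + 2) * norm (x (k * l) - w) \<le> (2 ^ l + 2) * (r * m)"
        using p2 by (intro mult_left_mono) auto
      then show ?thesis using r by simp
    qed
    \<comment> \<open>Both claims go through one induction: closeness to \<open>w\<close> licenses
      the next cycle estimate, and decay of the distance keeps the accumulated movement
      summable.\<close>
    have inv: "norm (x (k * l) - w) \<le> r + c * r * (\<Sum>i<k. \<rho> ^ i) \<and> a k \<le> r * \<rho> ^ k" for k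
    proof (induction k)
      case 0
      then show ?case using x0w infdist_le[OF S(2), of "x 0"] by (simp add: a_def dist_norm)
    next
      case (Suc k)
      note st = step[OF near_bound[OF conjunct1[OF Suc]]]
      have "norm (x (k * l + l) - x (k * l)) \<le> c * a k" using st by blast
      also have "\<dots> \<le> c * (r * \<rho> ^ k)" using Suc c by (intro mult_left_mono) auto
      finally have "norm (x (Suc k * l) - x (k * l)) \<le> c * r * \<rho> ^ k"
        by (simp add: add.commute mult.assoc)
      then have "norm (x (Suc k * l) - w) \<le> r + c * r * (\<Sum>i<Suc k. \<rho> ^ i)"
        using Suc norm_triangle_ineq[of "x (Suc k * l) - x (k * l)" "x (k * l) - w"]
        by (simp add: distrib_left)
      moreover have "a (Suc k) \<le> r * \<rho> ^ Suc k"
      proof -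
        have "\<rho> * a k \<le> \<rho> * (r * \<rho> ^ k)" using Suc rho by (intro mult_left_mono) auto
        then show ?thesis using st by (simp add: mult_ac)
      qed
      ultimately show ?case by blast
    qed
    have move: "norm (x (k * l + i) - x (k * l)) \<le> c * r * \<rho> ^ k" if "i \<le> l" for k i
    proof -
      have "norm (x (k * l + i) - x (k * l)) \<le> c * a k"
        using step[OF near_bound] inv that by blast
      also have "\<dots> \<le> c * (r * \<rho> ^ k)" using inv c by (intro mult_left_mono) auto
      finally show ?thesis by (simp add: mult.assoc)
    qed
    have "norm (x (Suc k * l) - x (k * l)) \<le> c * r * \<rho> ^ k" for k
      using move[of l k] by (simp add: add.commute)
    then obtain xbar where lim: "(\<lambda>k. x (k * l)) \<longlonglongrightarrow> xbar" and
      rate: "\<And>k. norm (x (k * l) - xbar) \<le> c * r / (1 - \<rho>) * \<rho> ^ k"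
      using geometric_steps_converge[of "\<lambda>k. x (k * l)" "c * r" \<rho>] rho c r
      by (metis less_imp_le mult_pos_pos)
    \<comment> \<open>Compare with the start of the current cycle, whose rate is known; the movement
      inside the cycle decays at the same rate.\<close>
    have "norm (x n - xbar) \<le> (c * r + c * r / (1 - \<rho>)) * \<rho> ^ (n div l)" for n
    proof -
      have "n mod l \<le> l" using \<open>0 < l\<close> by (simp add: less_imp_le)
      from move[OF this, of "n div l"]
      have "norm (x n - x (n div l * l)) \<le> c * r * \<rho> ^ (n div l)" by simp
      then show ?thesis
        using rate[of "n div l"] norm_triangle_ineq[of "x n - x (n div l * l)" "x (n div l * l) - xbar"]
        by (simp add: distrib_right)
    qed
    moreover have "0 \<le> c * r + c * r / (1 - \<rho>)" using c r rho by simp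
    ultimately have "R_linearly_convergent x xbar"
      using geometric_blocks_R_linear[OF \<open>0 < l\<close> rho(1,2)] by blast
    moreover have "xbar \<in> S"
    proof -
      have "a \<longlonglongrightarrow> infdist xbar S"
        unfolding a_def by (rule tendsto_infdist[OF lim])
      moreover have "(\<lambda>k. r * \<rho> ^ k) \<longlonglongrightarrow> r * 0"
        using rho by (intro tendsto_mult tendsto_const LIMSEQ_power_zero) auto
      ultimately have "infdist xbar S \<le> r * 0"
        using inv by (intro LIMSEQ_le) auto
      then show ?thesis
        using in_closed_iff_infdist_zero[OF S(1)] S(2) infdist_nonneg[of xbar S] by fastforce
    qed
    ultimately show ?thesis by blast
  qed
  then show ?thesis using r(1) unfolding S_def by blast
qed

section \<open>Closedness of the sets \<open>Z j\<close>, connectedness, and assembly\<close>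

text \<open>Sums of closed sets can fail to be closed. Here differences of the
  \<open>K\<close>-components are orthogonal to differences of the other components, so convergence
  of the sums makes the \<open>K\<close>-components Cauchy.\<close>

lemma closed_plus_orthogonal_comp:
  fixes K L :: "'a::euclidean_space set"
  assumes "closed K" "K \<subseteq> L"
  shows "closed (K + orthogonal_comp (minkowski_diff L L))"
proof (unfold closed_sequential_limits, intro allI impI, elim conjE)
  let ?V = "minkowski_diff L L"
  fix z x assume "\<forall>n::nat. z n \<in> K + orthogonal_comp ?V" and lim: "z \<longlonglongrightarrow> x"
  then have "\<forall>n. \<exists>c v. c \<in> K \<and> v \<in> orthogonal_comp ?V \<and> z n = c + v"
    by (meson set_plus_elim)
  then obtain c v where c: "\<And>n. c n \<in> K" and v: "\<And>n. v n \<in> orthogonal_comp ?V"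
    and zz: "\<And>n. z n = c n + v n"
    by metis
  have le: "dist (c i) (c j) \<le> dist (z i) (z j)" for i j
  proof -
    have "c i - c j \<in> ?V" using c assms(2) by (auto simp: minkowski_diff_def)
    moreover have "v i - v j \<in> orthogonal_comp ?V"
      using v by (intro subspace_diff subspace_orthogonal_comp)
    ultimately have "norm (c i - c j) \<le> norm ((c i - c j) + (v i - v j))"
      using orthogonal_comp_inner norm_add_orthogonal(1) by blast
    then show ?thesis by (simp add: dist_norm zz algebra_simps)
  qed
  have "Cauchy z" using lim by (rule LIMSEQ_imp_Cauchy)
  then have "Cauchy c" unfolding Cauchy_def by (meson le le_less_trans)
  then obtain y where y: "c \<longlonglongrightarrow> y" by (meson Cauchy_convergent convergent_def)
  have "y \<in> K" using assms(1) c y unfolding closed_sequential_limits by blast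
  moreover have "x - y \<in> orthogonal_comp ?V"
  proof -
    have "(\<lambda>n. z n - c n) \<longlonglongrightarrow> x - y" by (intro tendsto_diff lim y)
    then have "v \<longlonglongrightarrow> x - y" by (simp add: zz)
    then show ?thesis
      using closed_subspace[OF subspace_orthogonal_comp] v unfolding closed_sequential_limits by blast
  qed
  ultimately have "y + (x - y) \<in> K + orthogonal_comp ?V" by (rule set_plus_intro)
  then show "x \<in> K + orthogonal_comp ?V" by simp
qed

text \<open>Induction along an undirected path. It is applied with \<open>f i\<close> the projection
  of the limit onto \<open>C i\<close>.\<close>

lemma connected_algorithm_eq:
  assumes "connected_algorithm m l s t" "\<And>j. j \<in> {1..l} \<Longrightarrow> f (s j) = f (t j)"
    and "i \<in> {1..m}" "i' \<in> {1..m}"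
  shows "f i = f i'"
proof -
  let ?G = "\<lparr>verts = {1..m}, arcs = {1..l}, tail = s, head = t\<rparr>"
  have "(i, i') \<in> rtrancl_on {1..m} (\<Union>j\<in>{1..l}. {(s j, t j), (t j, s j)})"
    using assms(1,3,4)
    by (simp add: connected_algorithm_def connected_def strongly_connected_def reachable_def
        mk_symmetric_def)
  then show ?thesis
    by (induction rule: rtrancl_on_induct) (use assms(2) in auto)
qed

theorem theorem5p8:
  fixes m l :: nat
    and C :: "nat \<Rightarrow> 'a::euclidean_space set"
    and lam mu \<alpha> :: "nat \<Rightarrow> real"
    and s t :: "nat \<Rightarrow> nat"
    and T :: "nat \<Rightarrow> 'a \<Rightarrow> 'a set"
    and L Z :: "nat \<Rightarrow> 'a set"
    and w :: 'a
  assumes "m > 0" and "l > 0"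
    and "\<And>i. i \<in> {1..m} \<Longrightarrow> closed (C i)"
    and "(\<Inter>i\<in>{1..m}. C i) \<noteq> {}"
    and "\<And>j. j \<in> {1..l} \<Longrightarrow> lam j \<in> {0<..2}"
    and "\<And>j. j \<in> {1..l} \<Longrightarrow> mu j \<in> {0<..2}"
    and "\<And>j. j \<in> {1..l} \<Longrightarrow> \<alpha> j \<in> {0<..<1 + beta_hat (lam j) (mu j)}"
    and "\<And>j. j \<in> {1..l} \<Longrightarrow> s j \<noteq> t j"
    and "s ` {1..l} \<union> t ` {1..l} = {1..m}"
    and T: "\<And>j. j \<in> {1..l} \<Longrightarrow>
              T j = relaxed_operator (\<alpha> j) (lam j) (C (s j)) (mu j) (C (t j))"
    and L: "\<And>j. j \<in> {1..l} \<Longrightarrow> L j = affine hull (C (s j) \<union> C (t j))"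
    and Z: "\<And>j. j \<in> {1..l} \<Longrightarrow>
              Z j = (if lam j = 2 \<and> mu j = 2
                     then (C (s j) \<inter> C (t j)) + orthogonal_comp (minkowski_diff (L j) (L j))
                     else C (s j) \<inter> C (t j))"
    and "w \<in> (\<Inter>i\<in>{1..m}. C i)"
    and "linearly_regular_around {1..l} Z w"
    and "\<And>i. i \<in> {1..m} \<Longrightarrow> superregular_at (C i) w"
    and "\<And>j. j \<in> {1..l} \<Longrightarrow> min (lam j) (mu j) < 2 \<Longrightarrow> linearly_regular_around {s j, t j} C w"
    and "\<And>j. j \<in> {1..l} \<Longrightarrow> \<not> min (lam j) (mu j) < 2 \<Longrightarrow>
              affine_hull_regular_at (C (s j)) (C (t j)) w"
  shows "(\<Inter>j\<in>{1..l}. Z j) \<subseteq> (\<Inter>j\<in>{1..l}. Fix (T j)) \<and>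
         (\<exists>r>0. \<forall>x. cyclic_sequence l T x \<and> x 0 \<in> cball w r \<longrightarrow>
            (\<exists>xbar. R_linearly_convergent x xbar \<and> xbar \<in> (\<Inter>j\<in>{1..l}. Z j) \<and>
               (connected_algorithm m l s t \<longrightarrow>
                  (\<exists>p \<in> (\<Inter>i\<in>{1..m}. C i). \<forall>i\<in>{1..m}. projector (C i) xbar = {p}))))"
proof (intro conjI)
  note closedC = assms(3) and lam = assms(5) and mu = assms(6) and \<alpha> = assms(7)
    and cover = assms(9) and w = assms(13) and regularZ = assms(14) and superC = assms(15)
    and regularC = assms(16) and ahr = assms(17)
  have st: "s j \<in> {1..m}" "t j \<in> {1..m}" if "j \<in> {1..l}" for j
    using cover that by blast+
  have wC: "w \<in> C i" if "i \<in> {1..m}" for i using w that by blast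
  have sub: "C (s j) \<subseteq> L j" "C (t j) \<subseteq> L j" if "j \<in> {1..l}" for j
    using L[OF that] hull_subset[of "C (s j) \<union> C (t j)" affine] by auto
  \<comment> \<open>For two reflections, translation invariance carries the fixed point
    \<open>c\<close> to \<open>c + v\<close>.\<close>
  have fixed: "z \<in> T j z" if j: "j \<in> {1..l}" and z: "z \<in> Z j" for j z
  proof (cases "lam j = 2 \<and> mu j = 2")
    case True
    then obtain c v where c: "c \<in> C (s j)" "c \<in> C (t j)"
      and v: "v \<in> orthogonal_comp (minkowski_diff (L j) (L j))" and "z = c + v"
      using z unfolding Z[OF j] by (auto elim: set_plus_elim)
    then show ?thesis
      using relaxed_operator_reflections_translate[OF sub[OF j] v relaxed_operator_common_point[OF c]]
        True T[OF j] by simp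
  next
    case False
    then have "z \<in> C (s j)" "z \<in> C (t j)" using z Z[OF j] by auto
    then show ?thesis unfolding T[OF j] by (rule relaxed_operator_common_point)
  qed
  show "(\<Inter>j\<in>{1..l}. Z j) \<subseteq> (\<Inter>j\<in>{1..l}. Fix (T j))"
    using fixed by (auto simp: Fix_def)

  \<comment> \<open>Both projections of \<open>z = c + v\<close> equal \<open>c\<close>; without the
    offset both are \<open>z\<close> itself. Hence adjacent sets project a point of
    \<open>Z j\<close> to the same singleton.\<close>
  have shared: "\<exists>p. p \<in> C (s j) \<inter> C (t j) \<and> projector (C (s j)) z = {p} \<and> projector (C (t j)) z = {p}"
    if j: "j \<in> {1..l}" and z: "z \<in> Z j" for j z
  proof (cases "lam j = 2 \<and> mu j = 2")
    case True
    then obtain c v where c: "c \<in> C (s j)" "c \<in> C (t j)"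
      and v: "v \<in> orthogonal_comp (minkowski_diff (L j) (L j))" and zz: "z = c + v"
      using z unfolding Z[OF j] by (auto elim: set_plus_elim)
    have "projector (C (s j)) z = {c}" "projector (C (t j)) z = {c}"
      unfolding zz projector_translate[OF sub(1)[OF j] v] projector_translate[OF sub(2)[OF j] v]
      using c by (auto simp: projector_self)
    then show ?thesis using c by blast
  next
    case False
    then have "z \<in> C (s j)" "z \<in> C (t j)" using z Z[OF j] by auto
    then show ?thesis by (auto simp: projector_self)
  qed
  have closedZ: "closed (Z j)" if j: "j \<in> {1..l}" for j
    unfolding Z[OF j] using closedC[OF st(1)[OF j]] closedC[OF st(2)[OF j]] sub(1)[OF j]
    by (auto intro!: closed_plus_orthogonal_comp)
  have wZ: "w \<in> Z j" if j: "j \<in> {1..l}" for j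
  proof -
    have "w \<in> C (s j) \<inter> C (t j)" using wC st[OF j] by blast
    moreover from set_plus_intro[OF this subspace_0[OF subspace_orthogonal_comp]]
    have "w \<in> C (s j) \<inter> C (t j) + orthogonal_comp (minkowski_diff (L j) (L j))" by simp
    ultimately show ?thesis unfolding Z[OF j] by simp
  qed
  have fejer: "\<exists>\<beta>>0. \<forall>\<epsilon>>0. \<exists>\<delta>>0. \<forall>x\<in>cball w \<delta>. \<forall>z\<in>Z j \<inter> cball w \<delta>.
      \<forall>y\<in>T j x. (norm (y - z))\<^sup>2 \<le> (1 + \<epsilon>) * (norm (x - z))\<^sup>2 - \<beta> * (norm (x - y))\<^sup>2"
    and coercive: "\<exists>\<nu>>0. \<exists>\<delta>>0. \<forall>x\<in>cball w \<delta>. \<forall>y\<in>T j x. \<nu> * infdist x (Z j) \<le> norm (x - y)"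
    if j: "j \<in> {1..l}" for j
  proof -
    note A = superC[OF st(1)[OF j]] and B = superC[OF st(2)[OF j]]
      and wA = wC[OF st(1)[OF j]] and wB = wC[OF st(2)[OF j]]
      and clA = closedC[OF st(1)[OF j]] and clB = closedC[OF st(2)[OF j]]
    have l2: "0 < lam j" "lam j \<le> 2" and m2: "0 < mu j" "mu j \<le> 2" using lam[OF j] mu[OF j] by auto
    have a: "0 < \<alpha> j" "\<alpha> j < 1 + beta_hat (lam j) (mu j)" using \<alpha>[OF j] by auto
    have "(\<exists>\<beta>>0. \<forall>\<epsilon>>0. \<exists>\<delta>>0. \<forall>x\<in>cball w \<delta>. \<forall>z\<in>Z j \<inter> cball w \<delta>.
      \<forall>y\<in>T j x. (norm (y - z))\<^sup>2 \<le> (1 + \<epsilon>) * (norm (x - z))\<^sup>2 - \<beta> * (norm (x - y))\<^sup>2) \<and>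
      (\<exists>\<nu>>0. \<exists>\<delta>>0. \<forall>x\<in>cball w \<delta>. \<forall>y\<in>T j x. \<nu> * infdist x (Z j) \<le> norm (x - y))"
    proof (cases "lam j = 2 \<and> mu j = 2")
      case True
      then have 2: "T j = relaxed_operator (\<alpha> j) 2 (C (s j)) 2 (C (t j))"
        "Z j = (C (s j) \<inter> C (t j)) + orthogonal_comp (minkowski_diff (L j) (L j))"
        and a1: "\<alpha> j < 1" and reg: "affine_hull_regular_at (C (s j)) (C (t j)) w"
        using T[OF j] Z[OF j] a(2) ahr[OF j] by (auto simp: beta_hat_def)
      show ?thesis
        unfolding 2
        using reflections_fejer[OF A B wA wB a(1) a1 L[OF j]]
          reflections_coercive[OF clA clB A wA wB a(1) reg L[OF j]]
        by (rule conjI)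
    next
      case False
      \<comment> \<open>Both parameters are at most 2, so the split used in \<open>Z j\<close>
        agrees with the split of the regularity hypotheses.\<close>
      then have min: "min (lam j) (mu j) < 2" using l2 m2 by (auto simp: min_def)
      have Zj: "Z j = C (s j) \<inter> C (t j)" using False Z[OF j] by auto
      obtain d \<kappa> where reg: "d > 0" "\<kappa> > 0" "\<forall>x\<in>cball w d. infdist x (C (s j) \<inter> C (t j)) \<le>
          \<kappa> * max (infdist x (C (s j))) (infdist x (C (t j)))"
        using regularC[OF j min] unfolding linearly_regular_around_def by auto
      show ?thesis
        unfolding Zj T[OF j]
        using relaxed_operator_fejer[OF A B wA wB l2 m2 a]
          relaxed_operator_coercive[OF A B wA wB l2 m2 a(1) clA clB min reg]
        by (rule conjI)
    qed
    then show "\<exists>\<beta>>0. \<forall>\<epsilon>>0. \<exists>\<delta>>0. \<forall>x\<in>cball w \<delta>. \<forall>z\<in>Z j \<inter> cball w \<delta>.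
      \<forall>y\<in>T j x. (norm (y - z))\<^sup>2 \<le> (1 + \<epsilon>) * (norm (x - z))\<^sup>2 - \<beta> * (norm (x - y))\<^sup>2"
      and "\<exists>\<nu>>0. \<exists>\<delta>>0. \<forall>x\<in>cball w \<delta>. \<forall>y\<in>T j x. \<nu> * infdist x (Z j) \<le> norm (x - y)"
      by (rule conjunct1, rule conjunct2)
  qed
  have common: "\<exists>p\<in>(\<Inter>i\<in>{1..m}. C i). \<forall>i\<in>{1..m}. projector (C i) z = {p}"
    if z: "z \<in> (\<Inter>j\<in>{1..l}. Z j)" and conn: "connected_algorithm m l s t" for z
  proof -
    have eq: "projector (C (s j)) z = projector (C (t j)) z" if j: "j \<in> {1..l}" for j
      using shared[OF j] z j by blast
    have one: "1 \<in> {1..m}" using \<open>m > 0\<close> by simp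
    \<comment> \<open>Some operator uses \<open>C 1\<close>, so its projection is a singleton;
      connectedness spreads this singleton to all sets, and its element then lies in each of
      them.\<close>
    then consider j where "j \<in> {1..l}" "s j = 1" | j where "j \<in> {1..l}" "t j = 1"
      using cover by (metis (no_types, lifting) UnE imageE)
    then obtain p where "projector (C 1) z = {p}"
      using shared z by cases (metis INT_iff)+
    then have all: "projector (C i) z = {p}" if "i \<in> {1..m}" for i
      using connected_algorithm_eq[OF conn, of "\<lambda>i. projector (C i) z" i 1, OF eq that one] by simp
    moreover have "p \<in> C i" if "i \<in> {1..m}" for i
      using all[OF that] projector_iff[of p "C i" z] by simp
    ultimately show ?thesis by blast
  qed
  show "\<exists>r>0. \<forall>x. cyclic_sequence l T x \<and> x 0 \<in> cball w r \<longrightarrow>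
      (\<exists>xbar. R_linearly_convergent x xbar \<and> xbar \<in> (\<Inter>j\<in>{1..l}. Z j) \<and>
        (connected_algorithm m l s t \<longrightarrow>
          (\<exists>p \<in> (\<Inter>i\<in>{1..m}. C i). \<forall>i\<in>{1..m}. projector (C i) xbar = {p})))"
    using cyclic_quasi_fejer_converges[OF \<open>l > 0\<close> closedZ wZ regularZ fejer coercive] common
    by meson
qed

end
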